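(* Let $n\ge1$ and $r>0$, and let the round sphere $\mathbb{S}^{2n+1}(r)$ of radius $r$ be (isometrically) immersed in $\mathbb{R}^{2n+2}$ with normal degree one, i.e. with Gauss map of degree one. Then for every smooth unit vector field $\vec v$ on $\mathbb{S}^{2n+1}(r)$, $$E(\vec v)\ \geq\ \left(\frac{2n+1}{2}\,r^{2n+1}+\frac{n}{2n-1}\,r^{2n-1}\right)\mathrm{vol}(\mathbb{S}^{2n+1}).$$
   Context: $\mathbb{S}^{2n+1}$ is the unit round sphere in $\mathbb{R}^{2n+2}$. For a smooth unit vector field $\vec v$ on a compact oriented Riemannian manifold $M^m$ with Levi-Civita connection $\nabla$, the energy is $$E(\vec v)=\frac12\int_M\|\nabla\vec v\|^2+\frac m2\,\mathrm{vol}(M),$$ where $\|\nabla\vec v\|^2=\sum_{A,B}\langle\nabla_{e_B}\vec v,e_A\rangle^2$ for any local orthonormal frame $\{e_A\}$. Here $M=\mathbb{S}^{2n+1}(r)$ with its round metric and $m=2n+1$. The Gauss map of an oriented immersed hypersurface sends $x$ to the unit normal $N(x)\in\mathbb{S}^{2n+1}$ determined by the orientation. *)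

theory Defs
  imports "HOL-Analysis.Analysis" "HOL-Homology.Homology"
begin

subsection \<open>Smooth maps\<close>

text \<open>
  On a finite-dimensional space, \<open>f\<close> is \<open>C\<^sup>\<infinity>\<close> on an open set iff all its iterated
  directional derivatives exist and are differentiable there.
\<close>

primrec Ck_on ::
  "nat \<Rightarrow> 'a::euclidean_space set \<Rightarrow> ('a \<Rightarrow> 'b::real_normed_vector) \<Rightarrow> bool"
where
  "Ck_on 0 U f \<longleftrightarrow> continuous_on U f"
| "Ck_on (Suc k) U f \<longleftrightarrow>
     (\<forall>x\<in>U. f differentiable (at x)) \<and>
     (\<forall>w. Ck_on k U (\<lambda>x. frechet_derivative f (at x) w))"

definition smooth_on ::
  "'a::euclidean_space set \<Rightarrow> ('a \<Rightarrow> 'b::real_normed_vector) \<Rightarrow> bool"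
where
  "smooth_on U f \<longleftrightarrow> (\<forall>k. Ck_on k U f)"

text \<open>
  A map on an embedded submanifold \<open>S\<close> is smooth iff it extends smoothly to a neighbourhood of
  each point of \<open>S\<close>.  Values of \<open>f\<close> off \<open>S\<close> are irrelevant, here and in all that follows.
\<close>

definition smooth_map_on ::
  "'a::euclidean_space set \<Rightarrow> ('a \<Rightarrow> 'b::real_normed_vector) \<Rightarrow> bool"
where
  "smooth_map_on S f \<longleftrightarrow>
     (\<forall>x\<in>S. \<exists>U F. open U \<and> x \<in> U \<and> smooth_on U F \<and> (\<forall>y\<in>U \<inter> S. F y = f y))"


subsection \<open>Tangent spaces, differentials and the Levi-Civita connection of a round sphere\<close>

text \<open>The tangent space at \<open>x\<close> of the sphere centred at the origin through \<open>x\<close>.\<close>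

definition sphere_tangent :: "'a::euclidean_space \<Rightarrow> 'a set" where
  "sphere_tangent x = {X. x \<bullet> X = 0}"

definition sphere_proj :: "'a::euclidean_space \<Rightarrow> 'a \<Rightarrow> 'a" where
  "sphere_proj x y = y - ((x \<bullet> y) / (x \<bullet> x)) *\<^sub>R x"

text \<open>
  The differential at \<open>x\<close> of a map defined on the sphere.  A Frechet derivative within the sphere is
  determined only on tangent vectors \<open>X\<close>, and it is only applied to those; lemma
  \<open>sphere_differential_eq\<close> below shows that there it agrees with the derivative of any extension.
\<close>

definition sphere_differential ::
  "('a::euclidean_space \<Rightarrow> 'b::real_normed_vector) \<Rightarrow> 'a \<Rightarrow> 'a \<Rightarrow> 'b"
where
  "sphere_differential f x X = frechet_derivative f (at x within sphere 0 (norm x)) X"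

text \<open>
  The Levi-Civita connection of the metric induced from the ambient Euclidean space:
  \<open>\<nabla>\<^sub>X v\<close> at \<open>x\<close> is the tangential part of the ambient derivative.
\<close>

definition sphere_connection ::
  "('a::euclidean_space \<Rightarrow> 'a) \<Rightarrow> 'a \<Rightarrow> 'a \<Rightarrow> 'a"
where
  "sphere_connection v x X = sphere_proj x (sphere_differential v x X)"

definition orthonormal_basis_of :: "'a::euclidean_space set \<Rightarrow> 'a set \<Rightarrow> bool" where
  "orthonormal_basis_of T B \<longleftrightarrow>
     pairwise orthogonal B \<and> (\<forall>b\<in>B. norm b = 1) \<and> span B = T"

text \<open>
  The squared norm of \<open>\<nabla>v\<close> at \<open>x\<close>.  The frame is arbitrary: see \<open>nabla_norm_sq_eq\<close>.
\<close>

definition nabla_norm_sq :: "('a::euclidean_space \<Rightarrow> 'a) \<Rightarrow> 'a \<Rightarrow> real" where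
  "nabla_norm_sq v x =
     (let B = (SOME B. orthonormal_basis_of (sphere_tangent x) B)
      in \<Sum>a\<in>B. \<Sum>b\<in>B. (sphere_connection v x b \<bullet> a)\<^sup>2)"


subsection \<open>Riemannian measure and energy\<close>

text \<open>
  The Riemannian (surface) measure of the sphere of radius \<open>r\<close> about the origin, as the normalised
  cone measure: a Borel set \<open>A\<close> of the sphere has area \<open>DIM('a) / r\<close> times the Lebesgue measure of
  the cone \<open>{t *\<^sub>R a | t a. 0 < t \<and> t < 1 \<and> a \<in> A}\<close>.
\<close>

definition sphere_measure :: "real \<Rightarrow> 'a::euclidean_space measure" where
  "sphere_measure r =
     scale_measure (ennreal (real DIM('a) / r))
       (distr (restrict_space lborel (ball 0 r - {0})) (restrict_space borel (sphere 0 r))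
              (\<lambda>x. (r / norm x) *\<^sub>R x))"

definition sphere_vol :: "'a::euclidean_space itself \<Rightarrow> real \<Rightarrow> real" where
  "sphere_vol _ r = measure (sphere_measure r :: 'a measure) (sphere 0 r)"

definition unit_vector_field :: "real \<Rightarrow> ('a::euclidean_space \<Rightarrow> 'a) \<Rightarrow> bool" where
  "unit_vector_field r v \<longleftrightarrow>
     smooth_map_on (sphere 0 r) v \<and>
     (\<forall>x\<in>sphere 0 r. v x \<in> sphere_tangent x \<and> norm (v x) = 1)"

text \<open>The dimension \<open>m\<close> of the manifold is \<open>DIM('a) - 1\<close>.\<close>

definition energy :: "real \<Rightarrow> ('a::euclidean_space \<Rightarrow> 'a) \<Rightarrow> real" where
  "energy r v =
     1 / 2 * (\<integral>x. nabla_norm_sq v x \<partial>(sphere_measure r)) +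
     real (DIM('a) - 1) / 2 * sphere_vol TYPE('a) r"


subsection \<open>Isometric immersions and the degree of the Gauss map\<close>

definition isometric_immersion ::
  "real \<Rightarrow> ('a::euclidean_space \<Rightarrow> 'b::euclidean_space) \<Rightarrow> bool"
where
  "isometric_immersion r f \<longleftrightarrow>
     smooth_map_on (sphere 0 r) f \<and>
     (\<forall>x\<in>sphere 0 r. \<forall>X\<in>sphere_tangent x. \<forall>Y\<in>sphere_tangent x.
        sphere_differential f x X \<bullet> sphere_differential f x Y = X \<bullet> Y)"

text \<open>
  An orientation of the sphere is encoded by a sign \<open>\<epsilon>\<close>: \<open>1\<close> for the boundary orientation, in which
  a tangent basis \<open>e\<^sub>1, \<dots>, e\<^sub>m\<close> at \<open>x\<close> is positive iff \<open>x, e\<^sub>1, \<dots>, e\<^sub>m\<close> is a positive basis of the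
  ambient space, and \<open>-1\<close> for the opposite one.  The Gauss map sends \<open>x\<close> to the unit normal \<open>N\<close> of
  \<open>f\<close> for which \<open>N, df e\<^sub>1, \<dots>, df e\<^sub>m\<close> is positive whenever \<open>e\<^sub>1, \<dots>, e\<^sub>m\<close> is.  The linear map below
  sends \<open>x / r, e\<^sub>1, \<dots>, e\<^sub>m\<close> to \<open>N, df e\<^sub>1, \<dots>, df e\<^sub>m\<close>.
\<close>

definition gauss_map ::
  "real \<Rightarrow> int \<Rightarrow> (real ^ 'd \<Rightarrow> real ^ 'd) \<Rightarrow> real ^ 'd \<Rightarrow> real ^ ('d::finite)"
where
  "gauss_map r \<epsilon> f x =
     (THE N. norm N = 1 \<and>
        (\<forall>X\<in>sphere_tangent x. N \<bullet> sphere_differential f x X = 0) \<and>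
        of_int \<epsilon> *
          det (matrix (\<lambda>y. ((x \<bullet> y) / r) *\<^sub>R N + sphere_differential f x (sphere_proj x y))) > 0)"

text \<open>
  The Brouwer degree of a continuous self-map of the unit sphere, transported along an enumeration
  of the coordinates to the library's \<^term>\<open>nsphere\<close>.  Degrees of self-maps are invariant under
  conjugation by a homeomorphism, so the enumeration does not matter.
\<close>

definition to_nsphere :: "(nat \<Rightarrow> 'd) \<Rightarrow> real ^ 'd \<Rightarrow> nat \<Rightarrow> real" where
  "to_nsphere e x = (\<lambda>i. if i < CARD('d) then x $ e i else 0)"

definition of_nsphere :: "(nat \<Rightarrow> 'd) \<Rightarrow> (nat \<Rightarrow> real) \<Rightarrow> real ^ ('d::finite)" where
  "of_nsphere e y = (\<chi> j. y (inv_into {..<CARD('d)} e j))"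

definition sphere_degree :: "(real ^ 'd \<Rightarrow> real ^ ('d::finite)) \<Rightarrow> int" where
  "sphere_degree g =
     (let e = (SOME e. bij_betw e {..<CARD('d)} (UNIV :: 'd set))
      in Brouwer_degree2 (CARD('d) - 1) (to_nsphere e \<circ> g \<circ> of_nsphere e))"

text \<open>
  The degree of the Gauss map from the sphere of radius \<open>r\<close>, oriented by \<open>\<epsilon>\<close>, to the standardly
  oriented unit sphere; reversing the orientation of the domain changes the sign of the degree.
\<close>

definition normal_degree :: "real \<Rightarrow> int \<Rightarrow> (real ^ 'd \<Rightarrow> real ^ ('d::finite)) \<Rightarrow> int" where
  "normal_degree r \<epsilon> f = \<epsilon> * sphere_degree (\<lambda>u. gauss_map r \<epsilon> f (r *\<^sub>R u))"


subsection \<open>Independence of the choices made, and the total area\<close>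

lemma has_derivative_sphere_tangent_unique:
  fixes f :: "'a::euclidean_space \<Rightarrow> 'b::real_normed_vector"
  assumes "x \<noteq> 0" and X: "X \<in> sphere_tangent x"
    and D: "(f has_derivative D) (at x within sphere 0 (norm x))"
    and D': "(f has_derivative D') (at x within sphere 0 (norm x))"
  shows "D X = D' X"
proof (cases "X = 0")
  case True
  then show ?thesis
    using D D' by (simp add: has_derivative_def bounded_linear.linear linear_0)
next
  case False
  define s where "s = norm x / norm X"
  have s: "s > 0" using assms(1) False by (simp add: s_def)
  define c where "c t = cos t *\<^sub>R x + (sin t * s) *\<^sub>R X" for t :: real
  have c_norm: "norm (c t) = norm x" for t
  proof -
    have xX: "x \<bullet> X = 0" "X \<bullet> x = 0"
      using X by (auto simp: sphere_tangent_def inner_commute)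
    have "s\<^sup>2 * (X \<bullet> X) = x \<bullet> x"
      using False by (simp add: s_def power_divide power2_norm_eq_inner)
    moreover have "c t \<bullet> c t = (cos t)\<^sup>2 * (x \<bullet> x) + (sin t)\<^sup>2 * (s\<^sup>2 * (X \<bullet> X))"
      by (simp add: c_def inner_add_left inner_add_right xX power2_eq_square algebra_simps)
    ultimately have "c t \<bullet> c t = ((cos t)\<^sup>2 + (sin t)\<^sup>2) * (x \<bullet> x)"
      by (simp only: distrib_right)
    then show ?thesis by (simp add: norm_eq_sqrt_inner)
  qed
  have c0: "c 0 = x" by (simp add: c_def)
  have dc: "(c has_derivative (\<lambda>h. h *\<^sub>R s *\<^sub>R X)) (at 0)"
    unfolding c_def by (auto intro!: derivative_eq_intros)
  have "(f has_derivative E) (at (c 0) within range c)"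
    if "(f has_derivative E) (at x within sphere 0 (norm x))" for E
    unfolding c0 by (rule has_derivative_subset[OF that]) (auto simp: c_norm)
  then have "((\<lambda>t. f (c t)) has_derivative (\<lambda>h. E (h *\<^sub>R s *\<^sub>R X))) (at 0)"
    if "(f has_derivative E) (at x within sphere 0 (norm x))" for E
    using has_derivative_in_compose[OF dc] that by blast
  from has_derivative_unique[OF this[OF D] this[OF D']]
  have "D (1 *\<^sub>R s *\<^sub>R X) = D' (1 *\<^sub>R s *\<^sub>R X)" by metis
  then have "s *\<^sub>R D X = s *\<^sub>R D' X"
    using D D' by (simp add: has_derivative_def bounded_linear.linear linear_scale)
  then show ?thesis using s by simp
qed

lemma sphere_differential_eq:
  fixes f :: "'a::euclidean_space \<Rightarrow> 'b::real_normed_vector"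
  assumes "x \<noteq> 0" "X \<in> sphere_tangent x"
    and F: "(F has_derivative F') (at x)"
    and U: "open U" "x \<in> U" "\<And>y. y \<in> U \<Longrightarrow> norm y = norm x \<Longrightarrow> F y = f y"
  shows "sphere_differential f x X = F' X"
proof -
  have "(F has_derivative F') (at x within sphere 0 (norm x))"
    using F by (rule has_derivative_at_withinI)
  moreover obtain d where d: "d > 0" "\<And>y. dist x y < d \<Longrightarrow> y \<in> U"
    using U(1,2) by (metis openE mem_ball subsetD)
  ultimately have "(f has_derivative F') (at x within sphere 0 (norm x))"
    by - (erule has_derivative_transform_within[where d = d], use U(3) in \<open>auto simp: dist_commute\<close>)
  moreover from this have
    "(f has_derivative frechet_derivative f (at x within sphere 0 (norm x)))
       (at x within sphere 0 (norm x))"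
    using differentiableI frechet_derivative_works by blast
  ultimately show ?thesis
    unfolding sphere_differential_def
    using has_derivative_sphere_tangent_unique[OF assms(1,2)] by blast
qed

lemma orthonormal_basis_of_parseval:
  assumes "orthonormal_basis_of T B" "w \<in> T"
  shows "(\<Sum>b\<in>B. (w \<bullet> b)\<^sup>2) = w \<bullet> w"
proof -
  have B: "pairwise orthogonal B" "\<And>b. b \<in> B \<Longrightarrow> norm b = 1" "span B = T"
    using assms(1) by (auto simp: orthonormal_basis_of_def)
  have "0 \<notin> B" using B(2) by fastforce
  then have "independent B" using B(1) pairwise_orthogonal_independent by blast
  then have fin: "finite B" by (rule independent_imp_finite)
  have bb: "b \<bullet> c = (if b = c then 1 else 0)" if "b \<in> B" "c \<in> B" for b c
    using B(1,2) that by (auto simp: pairwise_def orthogonal_def dot_square_norm)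
  obtain k where k: "w = (\<Sum>b\<in>B. k b *\<^sub>R b)"
    using assms(2) B(3) span_finite[OF fin] by auto
  have wb: "w \<bullet> c = k c" if c: "c \<in> B" for c
  proof -
    have "w \<bullet> c = (\<Sum>b\<in>B. k b * (b \<bullet> c))"
      by (simp add: k inner_sum_left)
    also have "\<dots> = (\<Sum>b\<in>B. if b = c then k b else 0)"
      by (rule sum.cong) (auto simp: bb c)
    also have "\<dots> = k c" using fin c by simp
    finally show ?thesis .
  qed
  have "w \<bullet> w = w \<bullet> (\<Sum>b\<in>B. k b *\<^sub>R b)"
    by (rule arg_cong[OF k])
  also have "\<dots> = (\<Sum>b\<in>B. k b * (w \<bullet> b))"
    by (simp only: inner_sum_right inner_scaleR_right)
  finally have "w \<bullet> w = (\<Sum>b\<in>B. k b * (w \<bullet> b))" .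
  then show ?thesis by (simp add: wb power2_eq_square)
qed

lemma orthonormal_basis_of_exists: "\<exists>B. orthonormal_basis_of (sphere_tangent x) B"
proof -
  have "subspace (sphere_tangent x)"
    unfolding sphere_tangent_def by (rule subspace_hyperplane)
  then show ?thesis
    unfolding orthonormal_basis_of_def by (metis orthonormal_basis_subspace)
qed

lemma nabla_norm_sq_eq:
  fixes v :: "'a::euclidean_space \<Rightarrow> 'a"
  assumes v: "v differentiable (at x within sphere 0 (norm x))" and "x \<noteq> 0"
    and B: "orthonormal_basis_of (sphere_tangent x) B"
  shows "nabla_norm_sq v x = (\<Sum>a\<in>B. \<Sum>b\<in>B. (sphere_connection v x b \<bullet> a)\<^sup>2)"
proof -
  let ?T = "sphere_tangent x"
  let ?L = "sphere_connection v x"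
  have lin: "linear ?L"
  proof -
    have "linear (sphere_proj x)"
      by (rule linearI)
        (simp_all add: sphere_proj_def inner_add_right add_divide_distrib algebra_simps)
    moreover have "linear (sphere_differential v x)"
      unfolding sphere_differential_def
      using v by (simp add: linear_frechet_derivative)
    ultimately have "linear (sphere_proj x \<circ> sphere_differential v x)"
      by (rule linear_compose[rotated])
    then show ?thesis by (simp add: sphere_connection_def[abs_def] o_def)
  qed
  have LT: "?L X \<in> ?T" for X
    using \<open>x \<noteq> 0\<close>
    by (simp add: sphere_connection_def sphere_proj_def sphere_tangent_def inner_diff_right)
  have swap: "(\<Sum>a\<in>C. \<Sum>b\<in>C. (?L b \<bullet> a)\<^sup>2) = (\<Sum>a\<in>C'. \<Sum>b\<in>C'. (?L b \<bullet> a)\<^sup>2)"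
    if C: "orthonormal_basis_of ?T C" and C': "orthonormal_basis_of ?T C'" for C C'
  proof -
    let ?P = "sphere_proj x"
    have PT: "?P y \<in> ?T" for y
      using \<open>x \<noteq> 0\<close> by (simp add: sphere_proj_def sphere_tangent_def inner_diff_right)
    have TD: "b \<in> ?T" if "orthonormal_basis_of ?T D" "b \<in> D" for b D
      using that span_base by (auto simp: orthonormal_basis_of_def)
    have adj: "?L b \<bullet> a = ?P (adjoint ?L a) \<bullet> b" if "b \<in> ?T" for a b
      using that adjoint_works[OF lin, of b a]
      by (simp add: sphere_proj_def sphere_tangent_def inner_diff_left inner_diff_right inner_commute)
    have mixed: "(\<Sum>a\<in>D. \<Sum>b\<in>D. (?L b \<bullet> a)\<^sup>2) = (\<Sum>a\<in>D. \<Sum>b\<in>D'. (?L b \<bullet> a)\<^sup>2)"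
      if D: "orthonormal_basis_of ?T D" and D': "orthonormal_basis_of ?T D'" for D D'
    proof (rule sum.cong[OF refl])
      fix a
      have "(\<Sum>b\<in>D. (?L b \<bullet> a)\<^sup>2) = (\<Sum>b\<in>D. (?P (adjoint ?L a) \<bullet> b)\<^sup>2)"
        using adj TD[OF D] by (intro sum.cong) auto
      also have "\<dots> = (\<Sum>b\<in>D'. (?P (adjoint ?L a) \<bullet> b)\<^sup>2)"
        using orthonormal_basis_of_parseval[OF D PT] orthonormal_basis_of_parseval[OF D' PT]
        by simp
      also have "\<dots> = (\<Sum>b\<in>D'. (?L b \<bullet> a)\<^sup>2)"
        using adj TD[OF D'] by (intro sum.cong) auto
      finally show "(\<Sum>b\<in>D. (?L b \<bullet> a)\<^sup>2) = (\<Sum>b\<in>D'. (?L b \<bullet> a)\<^sup>2)" .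
    qed
    have "(\<Sum>a\<in>C. \<Sum>b\<in>C'. (?L b \<bullet> a)\<^sup>2) = (\<Sum>b\<in>C'. \<Sum>a\<in>C. (?L b \<bullet> a)\<^sup>2)"
      by (rule sum.swap)
    also have "\<dots> = (\<Sum>b\<in>C'. \<Sum>a\<in>C'. (?L b \<bullet> a)\<^sup>2)"
      by (simp add: orthonormal_basis_of_parseval[OF C LT] orthonormal_basis_of_parseval[OF C' LT])
    also have "\<dots> = (\<Sum>a\<in>C'. \<Sum>b\<in>C'. (?L b \<bullet> a)\<^sup>2)"
      by (rule sum.swap)
    finally show ?thesis using mixed[OF C C'] by simp
  qed
  show ?thesis
    unfolding nabla_norm_sq_def Let_def
    by (rule swap[OF someI_ex[OF orthonormal_basis_of_exists] B])
qed

lemma sphere_vol_eq: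
  assumes "r > 0"
  shows "sphere_vol TYPE('a::euclidean_space) r
           = real DIM('a) * r ^ (DIM('a) - 1) * measure lborel (ball (0::'a) 1)"
proof -
  let ?p = "\<lambda>x::'a. (r / norm x) *\<^sub>R x"
  let ?N = "restrict_space lborel (ball (0::'a) r - {0})"
  let ?S = "restrict_space borel (sphere (0::'a) r)"
  have "?p \<in> borel_measurable (restrict_space borel (ball 0 r - {0}))"
    by (rule borel_measurable_continuous_on_restrict) (auto intro!: continuous_intros)
  then have "?p \<in> borel_measurable ?N"
    by (subst measurable_cong_sets[OF sets_restrict_space_cong[OF sets_lborel] refl])
  then have p: "?p \<in> measurable ?N ?S"
    using assms by (intro measurable_restrict_space2) (auto simp: space_restrict_space)
  have "measure (distr ?N ?S ?p) (sphere 0 r) = measure ?N (?p -` sphere 0 r \<inter> space ?N)"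
    by (rule measure_distr[OF p]) (auto simp: sets_restrict_space)
  also have "?p -` sphere 0 r \<inter> space ?N = ball 0 r - {0}"
    using assms by (auto simp: space_restrict_space)
  also have "measure ?N (ball 0 r - {0}) = measure lborel (ball 0 r - {0::'a})"
    by (rule measure_restrict_space) auto
  also have "\<dots> = measure lborel (ball (0::'a) r)"
    by (rule measure_Diff_null_set) auto
  also have "\<dots> = r ^ DIM('a) * measure lborel (ball (0::'a) 1)"
    by (rule content_ball_conv_unit_ball) (use assms in simp)
  finally have "sphere_vol TYPE('a) r =
      real DIM('a) / r * (r ^ DIM('a) * measure lborel (ball (0::'a) 1))"
    unfolding sphere_vol_def sphere_measure_def
    by (subst measure_scale_measure) (use assms in simp_all)
  also have "r ^ DIM('a) = r * r ^ (DIM('a) - 1)"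
    by (rule power_eq_if[THEN trans]) simp
  finally show ?thesis using assms by simp
qed

end

theory Submission
  imports Defs
begin

text \<open>
  The bound follows from Milnor's volume argument.  Extend \<open>v\<close> to \<open>U x = \<bar>x\<bar> v (r x / \<bar>x\<bar>)\<close>, which is tangent to all spheres
  about the origin and satisfies \<open>\<bar>U x\<bar> = \<bar>x\<bar>\<close>, so that \<open>x + t U x\<close> has norm
  \<open>\<bar>x\<bar> sqrt (1 + t\<^sup>2)\<close>.  By Brouwer's theorem this map sends the ball of radius \<open>r\<close> onto the
  ball of radius \<open>r sqrt (1 + t\<^sup>2)\<close>, whence the integral of \<open>\<bar>det (1 + t A)\<bar>\<close>, \<open>A = DU\<close>, is at least
  \<open>(1 + t\<^sup>2)\<^bsup>n+1\<^esup>\<close> times the volume of the ball.  Adding this for \<open>t\<close> and \<open>- t\<close> and comparing the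
  terms in \<open>t\<^sup>2\<close> bounds the integral of \<open>(tr A)\<^sup>2 - tr A\<^sup>2\<close> from below.  In an orthonormal basis
  containing \<open>x / \<bar>x\<bar>\<close> and \<open>v\<close>, only a \<open>2n \<times> 2n\<close> block of \<open>A\<close> enters \<open>(tr A)\<^sup>2 - tr A\<^sup>2 - 2\<close>, and
  Cauchy-Schwarz bounds this by \<open>(2n - 1) r\<^sup>2 \<parallel>\<nabla>v\<parallel>\<^sup>2\<close>.
\<close>

subsection \<open>Determinants of small perturbations of the identity\<close>

text \<open>Splitting off one factor multiplies the old error by at most \<open>1 + K\<close> and
  adds a cross term of size \<open>t^2\<close>. The constant depends only on \<open>S\<close> and
  \<open>K\<close>: in the application the entries vary with the point, and the estimate is
  integrated.\<close>

lemma prod_one_plus_first_order: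
  fixes K :: real
  assumes "finite S" "K \<ge> 0"
  shows "\<exists>C\<ge>0. \<forall>a t. (\<forall>i\<in>S. \<bar>a i\<bar> \<le> K) \<longrightarrow> \<bar>t\<bar> \<le> 1 \<longrightarrow>
    \<bar>(\<Prod>i\<in>S. 1 + t * a i) - (1 + t * (\<Sum>i\<in>S. a i))\<bar> \<le> C * t\<^sup>2"
  using assms(1)
proof induction
  case empty
  then show ?case by (intro exI[of _ 0]) auto
next
  case (insert j S)
  then obtain C where C: "C \<ge> 0" "\<And>a t. (\<forall>i\<in>S. \<bar>a i\<bar> \<le> K) \<Longrightarrow> \<bar>t\<bar> \<le> 1 \<Longrightarrow>
    \<bar>(\<Prod>i\<in>S. 1 + t * a i) - (1 + t * (\<Sum>i\<in>S. a i))\<bar> \<le> C * t\<^sup>2"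
    by blast
  show ?case
  proof (intro exI conjI allI impI)
    show "0 \<le> (1 + K) * C + K * (of_nat (card S) * K)" using C assms(2) by simp
    fix a :: "'a \<Rightarrow> real" and t :: real
    assume a: "\<forall>i\<in>insert j S. \<bar>a i\<bar> \<le> K" and t: "\<bar>t\<bar> \<le> 1"
    let ?P = "\<Prod>i\<in>S. 1 + t * a i" and ?s = "\<Sum>i\<in>S. a i"
    have s: "\<bar>?s\<bar> \<le> of_nat (card S) * K"
      using a by (intro order_trans[OF sum_abs sum_bounded_above]) auto
    have "\<bar>t * a j\<bar> \<le> 1 * K" unfolding abs_mult using a t by (intro mult_mono) auto
    then have f: "\<bar>1 + t * a j\<bar> \<le> 1 + K" by linarith
    have "(\<Prod>i\<in>insert j S. 1 + t * a i) - (1 + t * (\<Sum>i\<in>insert j S. a i))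
        = (1 + t * a j) * (?P - (1 + t * ?s)) + t\<^sup>2 * (a j * ?s)"
      using insert by (simp add: algebra_simps power2_eq_square)
    also have "\<bar>\<dots>\<bar> \<le> \<bar>1 + t * a j\<bar> * \<bar>?P - (1 + t * ?s)\<bar> + t\<^sup>2 * (\<bar>a j\<bar> * \<bar>?s\<bar>)"
      by (rule order_trans[OF abs_triangle_ineq]) (simp add: abs_mult)
    also have "\<dots> \<le> (1 + K) * (C * t\<^sup>2) + t\<^sup>2 * (K * (of_nat (card S) * K))"
      using a t s f assms(2) by (intro add_mono mult_mono C(2)) auto
    finally show "\<bar>(\<Prod>i\<in>insert j S. 1 + t * a i) - (1 + t * (\<Sum>i\<in>insert j S. a i))\<bar>
        \<le> ((1 + K) * C + K * (of_nat (card S) * K)) * t\<^sup>2"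
      by (simp add: algebra_simps)
  qed
qed

text \<open>A permutation other than the identity moves at least two indices, some \<open>i\<close>
  and its image \<open>p i\<close>. At both of them the identity matrix contributes 0, so two
  factors are of order \<open>t\<close>.\<close>

lemma permutation_term_second_order:
  fixes A :: "real^'n^'n"
  assumes A: "\<And>i j. \<bar>A $ i $ j\<bar> \<le> K" and t: "\<bar>t\<bar> \<le> 1"
    and p: "p permutes UNIV" "p \<noteq> id"
  shows "\<bar>\<Prod>i\<in>UNIV. (mat 1 + t *\<^sub>R A) $ i $ p i\<bar> \<le> (1 + K) ^ CARD('n) * t\<^sup>2"
proof -
  have K: "K \<ge> 0" using A[of undefined undefined] by linarith
  obtain i where i: "p i \<noteq> i" using p(2) by fastforce
  define j where "j = p i"
  have j: "p j \<noteq> j" "i \<noteq> j"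
    using i p(1) by (auto simp: j_def dest: permutes_inj injD)
  let ?x = "\<lambda>i. \<bar>(mat 1 + t *\<^sub>R A) $ i $ p i\<bar>"
  have tA: "\<bar>t * A $ i $ k\<bar> \<le> \<bar>t\<bar> * K" for i k
    unfolding abs_mult using A by (intro mult_left_mono) auto
  have off: "?x k \<le> \<bar>t\<bar> * (1 + K)" if "p k \<noteq> k" for k
    using tA[of k "p k"] that by (simp add: mat_def algebra_simps)
  have gen: "?x k \<le> 1 + K" for k
  proof -
    have "\<bar>t\<bar> * K \<le> 1 * K" using t K by (intro mult_right_mono) auto
    then show ?thesis
      using tA[of k "p k"] by (cases "p k = k") (auto simp: mat_def)
  qed
  have "\<bar>\<Prod>i\<in>UNIV. (mat 1 + t *\<^sub>R A) $ i $ p i\<bar> = (\<Prod>k\<in>UNIV. ?x k)"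
    by (simp add: abs_prod)
  also have "\<dots> \<le> (\<Prod>k\<in>UNIV. (if k = i \<or> k = j then \<bar>t\<bar> * (1 + K) else 1 + K))"
    using off gen i j by (intro prod_mono) auto
  also have "\<dots> = (\<Prod>k\<in>UNIV. (if k = i then \<bar>t\<bar> else 1) * (if k = j then \<bar>t\<bar> else 1) * (1 + K))"
    using j by (intro prod.cong) auto
  also have "\<dots> = (1 + K) ^ CARD('n) * t\<^sup>2"
    by (simp add: prod.distrib prod.delta power2_eq_square)
  finally show ?thesis .
qed

text \<open>In the Leibniz formula the identity permutation gives the diagonal product, whose linear
  term is the trace; every other permutation contributes only at second order.\<close>

lemma det_one_plus_first_order:
  fixes K :: real
  assumes K: "K \<ge> 0"
  shows "\<exists>C\<ge>0. \<forall>(A :: real^'n^'n) t. (\<forall>i j. \<bar>A $ i $ j\<bar> \<le> K) \<longrightarrow> \<bar>t\<bar> \<le> 1 \<longrightarrow>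
    \<bar>det (mat 1 + t *\<^sub>R A) - (1 + t * trace A)\<bar> \<le> C * t\<^sup>2"
proof -
  obtain C where C: "C \<ge> 0" "\<And>a t. (\<forall>i\<in>UNIV::'n set. \<bar>a i\<bar> \<le> K) \<Longrightarrow> \<bar>t\<bar> \<le> 1 \<Longrightarrow>
    \<bar>(\<Prod>i\<in>UNIV. 1 + t * a i) - (1 + t * (\<Sum>i\<in>UNIV. a i))\<bar> \<le> C * t\<^sup>2"
    using prod_one_plus_first_order[OF _ K, of "UNIV :: 'n set"] by auto
  let ?P = "{p. p permutes (UNIV :: 'n set)}"
  let ?D = "of_nat (card (?P - {id})) * (1 + K) ^ CARD('n)"
  show ?thesis
  proof (intro exI conjI allI impI)
    show "0 \<le> C + ?D" using C K by simp
    fix A :: "real^'n^'n" and t :: real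
    assume A: "\<forall>i j. \<bar>A $ i $ j\<bar> \<le> K" and t: "\<bar>t\<bar> \<le> 1"
    let ?m = "\<lambda>p. \<Prod>i\<in>UNIV. (mat 1 + t *\<^sub>R A) $ i $ p i"
    have "det (mat 1 + t *\<^sub>R A) = (\<Sum>p\<in>?P. of_int (sign p) * ?m p)"
      by (simp add: det_def)
    also have "\<dots> = ?m id + (\<Sum>p\<in>?P - {id}. of_int (sign p) * ?m p)"
      by (subst sum.remove[of _ id]) (auto simp: permutes_id finite_permutations)
    also have "?m id = (\<Prod>i\<in>UNIV. 1 + t * A $ i $ i)"
      by (simp add: mat_def)
    finally have d: "det (mat 1 + t *\<^sub>R A) - (1 + t * trace A) =
        (\<Prod>i\<in>UNIV. 1 + t * A $ i $ i) - (1 + t * (\<Sum>i\<in>UNIV. A $ i $ i))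
        + (\<Sum>p\<in>?P - {id}. of_int (sign p) * ?m p)"
      by (simp add: trace_def id_def)
    have "\<bar>\<Sum>p\<in>?P - {id}. of_int (sign p) * ?m p\<bar> \<le> (\<Sum>p\<in>?P - {id}. \<bar>of_int (sign p) * ?m p\<bar>)"
      by (rule sum_abs)
    also have "\<dots> \<le> of_nat (card (?P - {id})) * ((1 + K) ^ CARD('n) * t\<^sup>2)"
    proof (rule sum_bounded_above)
      fix p assume "p \<in> ?P - {id}"
      then show "\<bar>of_int (sign p) * ?m p\<bar> \<le> (1 + K) ^ CARD('n) * t\<^sup>2"
        using permutation_term_second_order[of A K t p] A t
        by (simp add: abs_mult sign_def)
    qed
    finally show "\<bar>det (mat 1 + t *\<^sub>R A) - (1 + t * trace A)\<bar> \<le> (C + ?D) * t\<^sup>2"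
      unfolding d using C(2)[of "\<lambda>i. A $ i $ i" t] A t
      by (intro order_trans[OF abs_triangle_ineq]) (simp add: algebra_simps)
  qed
qed

text \<open>For small \<open>t\<close>, uniformly in \<open>A\<close>, both determinants are
  positive, so the absolute values disappear. The linear terms cancel in the sum, and the
  coefficient of \<open>t^2\<close> is twice the second elementary symmetric function of the
  eigenvalues.\<close>

lemma det_one_plus_minus_upper_bound:
  fixes K :: real
  assumes K: "K \<ge> 0"
  shows "\<exists>C \<delta>. \<delta> > 0 \<and> (\<forall>(A :: real^'n^'n) t. (\<forall>i j. \<bar>A $ i $ j\<bar> \<le> K) \<longrightarrow> 0 < t \<longrightarrow> t \<le> \<delta> \<longrightarrow>
    \<bar>det (mat 1 + t *\<^sub>R A)\<bar> + \<bar>det (mat 1 + (- t) *\<^sub>R A)\<bar>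
      \<le> 2 + t\<^sup>2 * ((trace A)\<^sup>2 - trace (A ** A)) + C * t ^ 3)"
proof -
  obtain C1 where C1: "C1 \<ge> 0" "\<And>(A :: real^'n^'n) t. (\<forall>i j. \<bar>A $ i $ j\<bar> \<le> K) \<Longrightarrow> \<bar>t\<bar> \<le> 1 \<Longrightarrow>
    \<bar>det (mat 1 + t *\<^sub>R A) - (1 + t * trace A)\<bar> \<le> C1 * t\<^sup>2"
    using det_one_plus_first_order[OF K] by blast
  \<comment> \<open>The entries of \<open>A ** A\<close> are bounded by this number, so the
    first-order expansion also applies to the square of \<open>A\<close>.\<close>
  have "CARD('n) * K\<^sup>2 \<ge> 0" by simp
  then obtain C2 where C2: "C2 \<ge> 0" "\<And>(A :: real^'n^'n) t. (\<forall>i j. \<bar>A $ i $ j\<bar> \<le> CARD('n) * K\<^sup>2) \<Longrightarrow>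
     \<bar>t\<bar> \<le> 1 \<Longrightarrow> \<bar>det (mat 1 + t *\<^sub>R A) - (1 + t * trace A)\<bar> \<le> C2 * t\<^sup>2"
    using det_one_plus_first_order by blast
  define T where "T = CARD('n) * K"
  have T: "T \<ge> 0" using K by (simp add: T_def)
  \<comment> \<open>Chosen so that the linear term and the error together stay below 1/2, which
    keeps both determinants positive.\<close>
  define \<delta> where "\<delta> = 1 / (2 * (T + C1 + 1))"
  have \<delta>: "\<delta> > 0" "\<delta> \<le> 1" "(T + C1) * \<delta> \<le> 1 / 2"
    using T C1 by (auto simp: \<delta>_def field_simps)
  define C where "C = 2 * T * C1 + C1\<^sup>2 + C2"
  show ?thesis
  proof (intro exI conjI allI impI)
    show "\<delta> > 0" by fact
    fix A :: "real^'n^'n" and t :: real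
    assume A: "\<forall>i j. \<bar>A $ i $ j\<bar> \<le> K" and t: "0 < t" "t \<le> \<delta>"
    have t1: "t \<le> 1" using t \<delta> by simp
    define p q \<tau> s where "p = det (mat 1 + t *\<^sub>R A)" and "q = det (mat 1 + (- t) *\<^sub>R A)"
      and "\<tau> = trace A" and "s = trace (A ** A)"
    have \<tau>: "\<bar>\<tau>\<bar> \<le> T"
      unfolding \<tau>_def trace_def T_def using A
      by (intro order_trans[OF sum_abs sum_bounded_above]) auto
    have AA: "\<forall>i j. \<bar>(A ** A) $ i $ j\<bar> \<le> CARD('n) * K\<^sup>2"
    proof (intro allI)
      fix i j
      show "\<bar>(A ** A) $ i $ j\<bar> \<le> CARD('n) * K\<^sup>2"
        unfolding matrix_matrix_mult_def power2_eq_square using A K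
        by (auto intro!: order_trans[OF sum_abs sum_bounded_above] mult_mono simp: abs_mult)
    qed
    define e1 e2 e3 where "e1 = p - (1 + t * \<tau>)" and "e2 = q - (1 - t * \<tau>)"
      and "e3 = p * q - (1 - t\<^sup>2 * s)"
    have e1: "\<bar>e1\<bar> \<le> C1 * t\<^sup>2" and e2: "\<bar>e2\<bar> \<le> C1 * t\<^sup>2"
      using C1(2)[of A t] C1(2)[of A "- t"] A t t1
      by (auto simp: e1_def e2_def p_def q_def \<tau>_def)
    have "(mat 1 + t *\<^sub>R A) ** (mat 1 + (- t) *\<^sub>R A) = mat 1 + (- t\<^sup>2) *\<^sub>R (A ** A)"
      by (simp add: matrix_eq matrix_vector_mult_add_rdistrib matrix_vector_right_distrib
          matrix_vector_mult_diff_rdistrib matrix_vector_mult_diff_distrib algebra_simps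
          power2_eq_square matrix_scaleR_vector_ac
          flip: matrix_vector_mul_assoc scaleR_matrix_vector_assoc)
    \<comment> \<open>The factors multiply to the identity minus \<open>t^2\<close> times the square
      of \<open>A\<close>. A first-order expansion with parameter \<open>- t^2\<close> therefore has
      an error of order \<open>t^4\<close>.\<close>
    then have "p * q = det (mat 1 + (- t\<^sup>2) *\<^sub>R (A ** A))"
      by (simp only: p_def q_def flip: det_mul)
    then have e3: "\<bar>e3\<bar> \<le> C2 * t ^ 4"
      using C2(2)[of "A ** A" "- t\<^sup>2"] AA t t1
      by (simp add: e3_def s_def power_le_one flip: power_mult)
    have t2: "t\<^sup>2 \<le> t" using t t1 by (simp add: power2_eq_square mult_left_le)
    have small: "\<bar>t * \<tau>\<bar> + C1 * t\<^sup>2 \<le> 1/2"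
    proof -
      have "\<bar>t * \<tau>\<bar> + C1 * t\<^sup>2 \<le> t * T + C1 * t"
        using t \<tau> C1(1) t2 by (auto simp: abs_mult intro!: add_mono mult_left_mono)
      also have "\<dots> = (T + C1) * t" by (simp add: algebra_simps)
      also have "\<dots> \<le> (T + C1) * \<delta>" using t T C1 by (intro mult_left_mono) auto
      finally show ?thesis using \<delta> by linarith
    qed
    have pos: "p > 0" "q > 0" using small e1 e2 unfolding e1_def e2_def by linarith+
    have t43: "t ^ 4 \<le> t ^ 3" using t t1 by (intro power_decreasing) auto
    have d: "\<bar>e1 - e2\<bar> \<le> 2 * C1 * t\<^sup>2" using e1 e2 by linarith
    \<comment> \<open>The second-order term of \<open>p + q\<close> comes from first-order expansions only: of \<open>p\<close>, of \<open>q\<close>,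
      and of \<open>p * q = det (1 - t\<^sup>2 A\<^sup>2)\<close>.\<close>
    have "(p + q)\<^sup>2 = (p - q)\<^sup>2 + 4 * (p * q)" by (simp add: power2_eq_square algebra_simps)
    also have "p - q = 2 * (t * \<tau>) + (e1 - e2)" by (simp add: e1_def e2_def)
    also have "p * q = 1 - t\<^sup>2 * s + e3" by (simp add: e3_def)
    finally have "(p + q)\<^sup>2 = 4 + 4 * (t\<^sup>2 * (\<tau>\<^sup>2 - s)) + (4 * (t * \<tau>) * (e1 - e2) + (e1 - e2)\<^sup>2 + 4 * e3)"
      by (simp add: power2_eq_square algebra_simps)
    moreover have "4 * (t * \<tau>) * (e1 - e2) \<le> 8 * T * C1 * t ^ 3"
    proof -
      have "4 * (t * \<tau>) * (e1 - e2) \<le> \<bar>4 * (t * \<tau>) * (e1 - e2)\<bar>" by simp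
      also have "\<dots> = 4 * t * (\<bar>\<tau>\<bar> * \<bar>e1 - e2\<bar>)" using t by (simp add: abs_mult)
      also have "\<dots> \<le> 4 * t * (T * (2 * C1 * t\<^sup>2))"
        using t \<tau> d T by (intro mult_left_mono mult_mono) auto
      finally show ?thesis by (simp add: power2_eq_square power3_eq_cube algebra_simps)
    qed
    moreover have "(e1 - e2)\<^sup>2 \<le> 4 * C1\<^sup>2 * t ^ 3"
    proof -
      have "(e1 - e2)\<^sup>2 \<le> (2 * C1 * t\<^sup>2)\<^sup>2" using d by (metis abs_ge_zero power2_abs power_mono)
      also have "\<dots> = 4 * C1\<^sup>2 * t ^ 4" by (simp add: power_mult_distrib flip: power_mult)
      also have "\<dots> \<le> 4 * C1\<^sup>2 * t ^ 3" using t43 by (intro mult_left_mono) auto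
      finally show ?thesis .
    qed
    moreover have "4 * e3 \<le> 4 * C2 * t ^ 3"
      using e3 mult_left_mono[OF t43 C2(1)] by linarith
    ultimately have "(p + q)\<^sup>2 \<le> 4 + 4 * (t\<^sup>2 * (\<tau>\<^sup>2 - s)) + 4 * (C * t ^ 3)"
      by (simp add: C_def algebra_simps)
    \<comment> \<open>The parabola lies above its tangent at 2; this turns the bound on the square
      of \<open>p + q\<close> into one on \<open>p + q\<close> without taking a root.\<close>
    moreover have "4 * (p + q) \<le> (p + q)\<^sup>2 + 4"
      using zero_le_power2[of "p + q - 2"] by (simp add: power2_eq_square algebra_simps)
    ultimately show "\<bar>det (mat 1 + t *\<^sub>R A)\<bar> + \<bar>det (mat 1 + (- t) *\<^sub>R A)\<bar>
      \<le> 2 + t\<^sup>2 * ((trace A)\<^sup>2 - trace (A ** A)) + C * t ^ 3"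
      using pos unfolding p_def[symmetric] q_def[symmetric] \<tau>_def[symmetric] s_def[symmetric]
      by simp
  qed
qed


subsection \<open>The volume inequality\<close>

text \<open>This is \<open>(tr L)\<^sup>2 - tr L\<^sup>2\<close>, in a form that is visibly continuous in \<open>L\<close>.\<close>

definition minor_sum :: "('a::euclidean_space \<Rightarrow> 'a) \<Rightarrow> real" where
  "minor_sum L = (\<Sum>b\<in>Basis. \<Sum>c\<in>Basis. (L b \<bullet> b) * (L c \<bullet> c) - (L b \<bullet> c) * (L c \<bullet> b))"

lemma sum_Basis_cart: "(\<Sum>b\<in>(Basis :: (real^'n) set). g b) = (\<Sum>i\<in>UNIV. g (axis i 1))"
proof -
  have B: "(Basis :: (real^'n) set) = range (\<lambda>i. axis i 1)"
    by (auto simp: Basis_vec_def)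
  have i: "inj (\<lambda>i::'n. axis i (1::real))"
    by (auto simp: inj_on_def axis_eq_axis)
  show ?thesis using sum.reindex[OF i, of g] unfolding B comp_def .
qed

lemma minor_sum_eq_trace:
  fixes L :: "real^'n \<Rightarrow> real^'n"
  shows "minor_sum L = (trace (matrix L))\<^sup>2 - trace (matrix L ** matrix L)"
  by (simp add: minor_sum_def sum_Basis_cart trace_def matrix_def matrix_matrix_mult_def
      inner_axis sum_subtractf power2_eq_square sum_product mult.commute)

text \<open>Links the Bochner integral, in which the energy is stated, with the gauge integral of
  the change of variables. Boundedness is assumed separately because the derivative of a homogeneous
  field need not have a limit at the origin of the punctured ball.\<close>

lemma integrable_continuous_bounded_lborel:
  fixes g :: "'a::euclidean_space \<Rightarrow> real"
  assumes g: "continuous_on S g" "\<And>x. x \<in> S \<Longrightarrow> \<bar>g x\<bar> \<le> M"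
    and S: "S \<in> sets borel" "bounded S"
  shows "integrable (restrict_space lborel S) g"
    and "g integrable_on S"
    and "(\<integral>x. g x \<partial>restrict_space lborel S) = integral S g"
proof -
  have fin: "finite_measure (restrict_space lborel S)"
    using S emeasure_bounded_finite[of S]
    by (intro finite_measureI) (simp add: space_restrict_space emeasure_restrict_space)
  have "g \<in> borel_measurable (restrict_space borel S)"
    by (rule borel_measurable_continuous_on_restrict[OF g(1)])
  then have m: "g \<in> borel_measurable (restrict_space lborel S)"
    by (subst measurable_cong_sets[OF sets_restrict_space_cong[OF sets_lborel] refl])
  show int: "integrable (restrict_space lborel S) g"
    by (rule finite_measure.integrable_const_bound[OF fin _ m, of M])
      (use g(2) in \<open>auto intro!: AE_I2 simp: space_restrict_space\<close>)
  then have "set_integrable lborel S g"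
    using S by (simp add: integrable_restrict_space set_integrable_def)
  from set_borel_integral_eq_integral[OF this]
  show "g integrable_on S" "(\<integral>x. g x \<partial>restrict_space lborel S) = integral S g"
    using S by (auto simp: integral_restrict_space set_lebesgue_integral_def)
qed

text \<open>A fixed point of \<open>x\<close> maps to \<open>y - t U x\<close> is a preimage of
  \<open>y\<close>. By Pythagoras the norm of \<open>x + t U x\<close> is that of \<open>x\<close>
  times \<open>sqrt (1 + t^2)\<close>, so the preimage lies in the ball of radius
  \<open>r\<close>.\<close>

lemma tangent_perturbation_covers_ball:
  fixes U :: "'a::euclidean_space \<Rightarrow> 'a"
  assumes cont: "continuous_on UNIV U" and nrm: "\<And>x. norm (U x) = norm x"
    and orth: "\<And>x. U x \<bullet> x = 0" and t: "\<bar>t\<bar> < 1"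
  shows "ball 0 (r * sqrt (1 + t\<^sup>2)) - {0} \<subseteq> (\<lambda>x. x + t *\<^sub>R U x) ` (ball 0 r - {0})"
proof
  fix y :: 'a assume y: "y \<in> ball 0 (r * sqrt (1 + t\<^sup>2)) - {0}"
  \<comment> \<open>\<open>R\<close> solves \<open>norm y + \<bar>t\<bar> * R = R\<close>, which
    makes the closed ball of radius \<open>R\<close> invariant.\<close>
  define R where "R = norm y / (1 - \<bar>t\<bar>)"
  have R: "R > 0" "norm y + \<bar>t\<bar> * R = R" using y t by (auto simp: R_def field_simps)
  obtain x where x: "x \<in> cball 0 R" "y - t *\<^sub>R U x = x"
  proof (rule brouwer_ball[OF R(1), of 0 "\<lambda>x. y - t *\<^sub>R U x"])
    show "continuous_on (cball 0 R) (\<lambda>x. y - t *\<^sub>R U x)"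
      by (intro continuous_intros continuous_on_subset[OF cont]) auto
    show "(\<lambda>x. y - t *\<^sub>R U x) \<in> cball 0 R \<rightarrow> cball 0 R"
    proof
      fix x :: 'a assume "x \<in> cball 0 R"
      then have "\<bar>t\<bar> * norm (U x) \<le> \<bar>t\<bar> * R" by (intro mult_left_mono) (auto simp: nrm)
      then show "y - t *\<^sub>R U x \<in> cball 0 R"
        using norm_triangle_ineq4[of y "t *\<^sub>R U x"] R(2) by simp
    qed
  qed
  then have xy: "x + t *\<^sub>R U x = y" by (metis diff_add_cancel)
  have "U x \<bullet> U x = x \<bullet> x" using nrm by (simp add: norm_eq)
  then have "y \<bullet> y = (x \<bullet> x) * (1 + t\<^sup>2)"
    using orth[of x] by (simp flip: xy add: inner_add_left inner_add_right inner_commute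
        power2_eq_square algebra_simps)
  then have ny: "norm y = norm x * sqrt (1 + t\<^sup>2)"
    by (simp add: norm_eq_sqrt_inner real_sqrt_mult)
  have "1 + t\<^sup>2 > 0" by (simp add: add_pos_nonneg)
  then have "norm x < r" "x \<noteq> 0" using y ny by auto
  then show "y \<in> (\<lambda>x. x + t *\<^sub>R U x) ` (ball 0 r - {0})"
    using xy by (intro image_eqI[of _ _ x]) auto
qed

text \<open>The covered ball has volume \<open>(1 + t^2) ^ k * V\<close>, which bounds the integral
  of the absolute Jacobian of \<open>x + t U x\<close> from below. Adding the bounds for
  \<open>t\<close> and \<open>- t\<close>, the constants \<open>2 * V\<close> cancel and the terms
  in \<open>t^2\<close> give the claim.\<close>

lemma minor_sum_integral_bound_cart:
  fixes U :: "real ^ 'n::{finite,wellorder} \<Rightarrow> real ^ 'n::_"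
    and A :: "real ^ 'n::_ \<Rightarrow> real ^ 'n::_ \<Rightarrow> real ^ 'n::_"
  assumes N: "CARD('n) = 2 * k" and r: "r > 0"
    and cont: "continuous_on UNIV U" and nrm: "\<And>x. norm (U x) = norm x"
    and orth: "\<And>x. U x \<bullet> x = 0"
    and der: "\<And>x. x \<noteq> 0 \<Longrightarrow> (U has_derivative A x) (at x)"
    and Acont: "\<And>w. continuous_on (- {0}) (\<lambda>x. A x w)"
    and Abd: "\<And>x w. x \<noteq> 0 \<Longrightarrow> norm (A x w) \<le> K * norm w"
  shows "2 * real k * measure lborel (ball (0 :: real^'n::_) r)
    \<le> (\<integral>x. minor_sum (A x) \<partial>restrict_space lborel (ball 0 r - {0}))"
proof -
  define S where "S = ball (0 :: real^'n::_) r - {0}"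
  define V where "V = measure lborel (ball (0 :: real^'n::_) r)"
  define M where "M x = matrix (A x)" for x
  have S: "S \<in> sets borel" "bounded S" "S \<subseteq> - {0}" by (auto simp: S_def)
  then have SL: "S \<in> lmeasurable" by (intro bounded_set_imp_lmeasurable) auto
  have V0: "V \<ge> 0" by (simp add: V_def)
  have MS: "measure lebesgue S = V"
    unfolding S_def V_def by (subst measure_Diff_null_set) (auto intro: null_sets_completionI)
  have K: "K \<ge> 0"
  proof -
    have "norm (A (axis undefined 1) (axis undefined 1)) \<le> K * norm (axis undefined (1::real) :: real^'n::_)"
      by (rule Abd) (simp add: axis_eq_0_iff)
    then show ?thesis by (simp add: norm_axis_1 order_trans[OF norm_ge_zero])
  qed
  have Mbd: "\<bar>M x $ i $ j\<bar> \<le> K" if "x \<in> S" for x i j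
    using Abd[of x "axis j 1"] that component_le_norm_cart[of "A x (axis j 1)" i]
    by (auto simp: M_def matrix_def S_def norm_axis_1)
  have Mcont: "continuous_on S (\<lambda>x. M x $ i $ j)" for i j
    using continuous_on_subset[OF Acont S(3)]
    by (auto simp: M_def matrix_def intro!: continuous_intros)
  \<comment> \<open>The bound \<open>K\<close> holds at all points, so one \<open>C\<close> and one
    \<open>\<delta>\<close> serve the whole punctured ball and the pointwise estimate can be
    integrated.\<close>
  obtain C \<delta> where \<delta>: "\<delta> > 0" and C: "\<And>(A :: real^'n::_^'n::_) t. (\<forall>i j. \<bar>A $ i $ j\<bar> \<le> K) \<Longrightarrow> 0 < t \<Longrightarrow> t \<le> \<delta> \<Longrightarrow>
    \<bar>det (mat 1 + t *\<^sub>R A)\<bar> + \<bar>det (mat 1 + (- t) *\<^sub>R A)\<bar>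
      \<le> 2 + t\<^sup>2 * ((trace A)\<^sup>2 - trace (A ** A)) + C * t ^ 3"
    using det_one_plus_minus_upper_bound[OF K, where 'n='n] by metis
  define \<sigma> where "\<sigma> x = (trace (M x))\<^sup>2 - trace (M x ** M x)" for x
  have \<sigma>: "minor_sum (A x) = \<sigma> x" for x
    by (simp add: minor_sum_eq_trace \<sigma>_def M_def)
  have \<sigma>cont: "continuous_on S \<sigma>"
    unfolding \<sigma>_def trace_def matrix_matrix_mult_def by (simp add: Mcont continuous_intros)
  have tr_bd: "\<bar>trace B\<bar> \<le> CARD('n) * L" if "\<And>i j. \<bar>B $ i $ j\<bar> \<le> L" for B :: "real^'n::_^'n::_" and L :: real
    unfolding trace_def using that by (intro order_trans[OF sum_abs sum_bounded_above]) auto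
  have mm_bd: "\<bar>(M x ** M x) $ i $ j\<bar> \<le> CARD('n) * K\<^sup>2" if "x \<in> S" for x i j
    unfolding matrix_matrix_mult_def power2_eq_square using Mbd[OF that] K
    by (auto intro!: order_trans[OF sum_abs sum_bounded_above] mult_mono simp: abs_mult)
  have \<sigma>bd: "\<bar>\<sigma> x\<bar> \<le> (CARD('n) * K)\<^sup>2 + CARD('n) * (CARD('n) * K\<^sup>2)" if "x \<in> S" for x
  proof -
    have "(trace (M x))\<^sup>2 \<le> (CARD('n) * K)\<^sup>2"
      using tr_bd[of "M x" K] Mbd[OF that] K by (simp add: abs_le_square_iff[symmetric])
    moreover have "\<bar>trace (M x ** M x)\<bar> \<le> CARD('n) * (CARD('n) * K\<^sup>2)"
      by (rule tr_bd) (rule mm_bd[OF that])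
    ultimately show ?thesis unfolding \<sigma>_def using zero_le_power2[of "trace (M x)"] by linarith
  qed
  note \<sigma>int = integrable_continuous_bounded_lborel[OF \<sigma>cont \<sigma>bd S(1,2)]
  define d where "d t x = \<bar>det (mat 1 + t *\<^sub>R M x)\<bar>" for t x
  have dint: "d t integrable_on S" if "\<bar>t\<bar> \<le> 1" for t
  proof (rule integrable_continuous_bounded_lborel(2)[OF _ _ S(1,2)])
    show "continuous_on S (d t)"
      unfolding d_def det_def by (simp add: Mcont continuous_intros)
    show "\<bar>d t x\<bar> \<le> fact CARD('n) * (1 + K) ^ CARD('n)" if x: "x \<in> S" for x
    proof -
      have e: "\<bar>(mat 1 + t *\<^sub>R M x) $ i $ j\<bar> \<le> 1 + K" for i j
      proof -
        have "\<bar>t\<bar> * \<bar>M x $ i $ j\<bar> \<le> 1 * K"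
          using Mbd[OF x] \<open>\<bar>t\<bar> \<le> 1\<close> by (intro mult_mono) auto
        moreover have "\<bar>(mat 1 :: real^'n::_^'n::_) $ i $ j\<bar> \<le> 1" by (simp add: mat_def)
        ultimately show ?thesis by (simp add: abs_mult[symmetric]) 
      qed
      have "\<bar>of_int (sign p) * (\<Prod>i\<in>UNIV. (mat 1 + t *\<^sub>R M x) $ i $ p i)\<bar> \<le> (1 + K) ^ CARD('n)" for p
      proof -
        have "(\<Prod>i\<in>UNIV. \<bar>(mat 1 + t *\<^sub>R M x) $ i $ p i\<bar>) \<le> (\<Prod>i\<in>(UNIV :: 'n set). 1 + K)"
          by (intro prod_mono) (use e in auto)
        then show ?thesis by (simp add: abs_mult sign_def abs_prod del: vector_add_component)
      qed
      then have "\<bar>det (mat 1 + t *\<^sub>R M x)\<bar> \<le> of_nat (card {p. p permutes (UNIV :: 'n set)}) * (1 + K) ^ CARD('n)"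
        unfolding det_def by (intro order_trans[OF sum_abs sum_bounded_above]) blast
      then show ?thesis by (simp add: d_def card_permutations)
    qed
  qed
  have vol: "(1 + t\<^sup>2) ^ k * V \<le> integral S (d t)" if t: "\<bar>t\<bar> < 1" for t
  proof -
    let ?f = "\<lambda>x. x + t *\<^sub>R U x"
    have df: "(?f has_derivative (\<lambda>w. w + t *\<^sub>R A x w)) (at x within S)" if "x \<in> S" for x
    proof (rule has_derivative_at_withinI)
      from that have "(U has_derivative A x) (at x)" by (intro der) (simp add: S_def)
      then show "(?f has_derivative (\<lambda>w. w + t *\<^sub>R A x w)) (at x)"
        by (intro has_derivative_add has_derivative_ident has_derivative_scaleR_right)
    qed
    have mat: "matrix (\<lambda>w. w + t *\<^sub>R A x w) = mat 1 + t *\<^sub>R M x" for x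
    proof -
      have "matrix (\<lambda>w. w + t *\<^sub>R A x w) $ i $ j = (mat 1 + t *\<^sub>R M x) $ i $ j" for i j
        by (cases "i = j") (simp_all add: M_def matrix_def mat_def axis_def)
      then show ?thesis by (simp add: vec_eq_iff)
    qed
    have int: "(\<lambda>x. \<bar>det (matrix (\<lambda>w. w + t *\<^sub>R A x w))\<bar>) integrable_on S"
      using dint[of t] t unfolding mat d_def[abs_def] by simp
    have SS: "S \<in> sets lebesgue" using SL by blast
    let ?B = "ball (0 :: real^'n::_) (r * sqrt (1 + t\<^sup>2))"
    \<comment> \<open>The dimension being \<open>2 * k\<close>, the square root in the radius
      becomes an integral power.\<close>
    have "(1 + t\<^sup>2) ^ k * V = (r * sqrt (1 + t\<^sup>2)) ^ (2 * k) * measure lborel (ball (0 :: real^'n::_) 1)"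
      unfolding V_def using r
      by (simp add: content_ball_conv_unit_ball[of r 0] N power_mult_distrib power_mult)
    also have "\<dots> = measure lborel ?B"
      using r by (simp add: content_ball_conv_unit_ball[of "r * sqrt (1 + t\<^sup>2)" 0] N)
    also have "\<dots> = measure lebesgue (?B - {0})"
      by (subst measure_Diff_null_set) (auto intro: null_sets_completionI)
    also have "\<dots> \<le> measure lebesgue (?f ` S)"
    proof (rule measure_mono_fmeasurable)
      show "?B - {0} \<subseteq> ?f ` S"
        unfolding S_def by (rule tangent_perturbation_covers_ball[OF cont nrm orth t])
      show "?f ` S \<in> lmeasurable"
        by (rule measurable_differentiable_image[OF SS df int])
    qed auto
    \<comment> \<open>The integral of the absolute Jacobian counts points with multiplicity, so it
      dominates the measure of the image.\<close>
    also have "\<dots> \<le> integral S (d t)"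
      using measure_differentiable_image[OF SS df int] unfolding mat d_def[abs_def] by simp
    finally show ?thesis .
  qed
  define I where "I = integral S \<sigma>"
  have key: "2 * real k * V \<le> I + C * V * t" if t: "0 < t" "t \<le> \<delta>" "t < 1" for t
  proof -
    have c: "(\<lambda>x. c) integrable_on S" "integral S (\<lambda>x. c) = c * V" for c :: real
      using SL MS by (auto simp: integrable_on_const lmeasure_integral
          simp flip: integral_mult_right[where f = "\<lambda>_. 1 :: real"])
    have s: "(\<lambda>x. t\<^sup>2 * \<sigma> x) integrable_on S" "integral S (\<lambda>x. t\<^sup>2 * \<sigma> x) = t\<^sup>2 * I"
      using integrable_cmul[OF \<sigma>int(2), of "t\<^sup>2"] by (simp_all add: I_def)
    have "- 1 \<le> t\<^sup>2" by (rule order_trans[of _ 0]) auto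
    \<comment> \<open>Bernoulli's inequality isolates the term in \<open>t^2\<close>; after
      cancelling \<open>2 * V\<close> one divides by \<open>t^2\<close>, and only an error linear in
      \<open>t\<close> remains.\<close>
    then have "2 * (1 + real k * t\<^sup>2) * V \<le> 2 * (1 + t\<^sup>2) ^ k * V"
      using Bernoulli_inequality[of "t\<^sup>2" k] V0 by (intro mult_right_mono) auto
    also have "\<dots> \<le> integral S (d t) + integral S (d (- t))"
      using vol[of t] vol[of "- t"] t by simp
    also have "\<dots> = integral S (\<lambda>x. d t x + d (- t) x)"
      using dint t by (subst integral_add) auto
    also have "\<dots> \<le> integral S (\<lambda>x. 2 + t\<^sup>2 * \<sigma> x + C * t ^ 3)"
    proof (rule integral_le)
      show "(\<lambda>x. d t x + d (- t) x) integrable_on S"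
        using dint t by (intro integrable_add) auto
      show "(\<lambda>x. 2 + t\<^sup>2 * \<sigma> x + C * t ^ 3) integrable_on S"
        using s c by (intro integrable_add) auto
      show "d t x + d (- t) x \<le> 2 + t\<^sup>2 * \<sigma> x + C * t ^ 3" if "x \<in> S" for x
        unfolding d_def \<sigma>_def using C[of "M x" t] Mbd[OF that] t by auto
    qed
    also have "\<dots> = 2 * V + t\<^sup>2 * I + C * t ^ 3 * V"
      using s c by (simp add: integral_add integrable_add)
    finally have "t\<^sup>2 * (2 * real k * V) \<le> t\<^sup>2 * (I + C * V * t)"
      by (simp add: algebra_simps power2_eq_square power3_eq_cube)
    then show ?thesis using t by simp
  qed
  have "2 * real k * V \<le> I"
  proof (rule tendsto_le[OF trivial_limit_at_right_real[of 0]])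
    show "((\<lambda>t. I + C * V * t) \<longlongrightarrow> I) (at_right 0)"
      by (auto intro!: tendsto_eq_intros)
    show "((\<lambda>t. 2 * real k * V) \<longlongrightarrow> 2 * real k * V) (at_right 0)" by simp
    show "\<forall>\<^sub>F t in at_right 0. 2 * real k * V \<le> I + C * V * t"
      unfolding eventually_at_right_field using \<delta> key
      by (intro exI[of _ "min \<delta> 1"]) auto
  qed
  then show ?thesis
    unfolding \<sigma> V_def I_def using \<sigma>int(3) by (simp add: S_def)
qed

text \<open>
  The change of variables theorems of the library need a well-ordered index type, whence a copy of
  the index type that carries a well-order.
\<close>

typedef ('d :: finite) idx = "{..<CARD('d)}"
  by (auto intro!: exI[of _ 0])

lemma bij_betw_Rep_idx: "bij_betw Rep_idx (UNIV :: 'd::finite idx set) {..<CARD('d)}"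
  using type_definition.Rep_range[OF type_definition_idx] Rep_idx_inject
  by (auto simp: bij_betw_def inj_on_def)

instance idx :: (finite) finite
  by standard (simp add: bij_betw_finite[OF bij_betw_Rep_idx])

lemma card_idx [simp]: "CARD('d::finite idx) = CARD('d)"
  using bij_betw_same_card[OF bij_betw_Rep_idx] by simp

instantiation idx :: (finite) linorder
begin
definition "a < b \<longleftrightarrow> Rep_idx a < Rep_idx b"
definition "a \<le> b \<longleftrightarrow> Rep_idx a \<le> Rep_idx b"
instance
  by intro_classes (auto simp: less_eq_idx_def less_idx_def Rep_idx_inject)
end

instance idx :: (finite) wellorder
proof -
  have "wf {(x :: 'a idx, y). x < y}"
    by (rule wf_subset[OF wf_measure[of Rep_idx]]) (auto simp: less_idx_def)
  then show "OFCLASS('a idx, wellorder_class)"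
    by (rule wf_wellorderI) intro_classes
qed

section \<open>Renaming of coordinates as a measure-preserving linear isometry\<close>

definition reindex :: "('i \<Rightarrow> 'j) \<Rightarrow> real ^ 'j \<Rightarrow> real ^ 'i" where
  "reindex e y = (\<chi> i. y $ e i)"

lemma bounded_linear_reindex: "bounded_linear (reindex e)"
  for e :: "'i::finite \<Rightarrow> 'j::finite"
  by (rule linear_conv_bounded_linear[THEN iffD1])
    (auto intro!: linearI simp: reindex_def vec_eq_iff)

lemma inner_reindex:
  assumes "bij e"
  shows "reindex e x \<bullet> reindex e y = x \<bullet> y"
  by (simp add: reindex_def inner_vec_def sum.reindex_bij_betw[OF assms, of "\<lambda>j. x $ j * y $ j"])

lemma norm_reindex: "bij e \<Longrightarrow> norm (reindex e x) = norm x"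
  by (simp add: norm_eq_sqrt_inner inner_reindex)

lemma reindex_reindex: "(\<And>i. e' (e i) = i) \<Longrightarrow> reindex e (reindex e' x) = x"
  by (simp add: reindex_def vec_eq_iff)

lemma reindex_axis: "(\<And>i. e' (e i) = i) \<Longrightarrow> (\<And>j. e (e' j) = j) \<Longrightarrow> reindex e (axis j c) = axis (e' j) c"
  by (auto simp: reindex_def vec_eq_iff axis_def)

lemma minor_sum_reindex:
  fixes L :: "real ^ 'i \<Rightarrow> real ^ 'i" and e :: "'i::finite \<Rightarrow> 'j::finite"
  assumes e: "\<And>i. e' (e i) = i" "\<And>j. e (e' j) = j"
  shows "minor_sum (\<lambda>w. reindex e' (L (reindex e w))) = minor_sum L"
proof -
  have b: "bij_betw e' UNIV UNIV" by (rule bij_betwI[of _ _ _ e]) (auto simp: e)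
  define m where "m i j = L (axis i 1) $ j" for i j
  have ent: "reindex e' (L (reindex e (axis j 1))) $ k = m (e' j) (e' k)" for j k
    by (simp add: reindex_axis[of e' e, OF e] m_def) (simp add: reindex_def)
  have "minor_sum (\<lambda>w. reindex e' (L (reindex e w)))
      = (\<Sum>j\<in>UNIV. \<Sum>k\<in>UNIV. m (e' j) (e' j) * m (e' k) (e' k) - m (e' j) (e' k) * m (e' k) (e' j))"
    by (simp add: minor_sum_def sum_Basis_cart inner_axis ent)
  also have "\<dots> = (\<Sum>j\<in>UNIV. \<Sum>k\<in>UNIV. m (e' j) (e' j) * m k k - m (e' j) k * m k (e' j))"
    by (rule sum.cong[OF refl], rule sum.reindex_bij_betw[OF b])
  also have "\<dots> = (\<Sum>j\<in>UNIV. \<Sum>k\<in>UNIV. m j j * m k k - m j k * m k j)"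
    by (rule sum.reindex_bij_betw[OF b])
  also have "\<dots> = minor_sum L"
    by (simp add: minor_sum_def sum_Basis_cart inner_axis m_def)
  finally show ?thesis .
qed

text \<open>Lebesgue measure is determined by its values on boxes, and the preimage of a box is a
  box with the same side lengths in another order.\<close>

lemma lborel_distr_reindex:
  fixes e :: "'i::finite \<Rightarrow> 'j::finite"
  assumes e: "\<And>i. e' (e i) = i" "\<And>j. e (e' j) = j"
  shows "distr lborel borel (reindex e) = lborel"
proof (rule lborel_eqI[symmetric])
  have m: "reindex e \<in> borel_measurable lborel"
    using borel_measurable_continuous_onI[OF linear_continuous_on[OF bounded_linear_reindex]] by simp
  have b: "bij_betw e UNIV UNIV" by (rule bij_betwI[of _ _ _ e']) (auto simp: e)
  fix l u :: "real ^ 'i" assume lu: "\<And>b. b \<in> Basis \<Longrightarrow> l \<bullet> b \<le> u \<bullet> b"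
  have le: "l $ i \<le> u $ i" for i using lu[of "axis i 1"] by (simp add: inner_axis axis_in_Basis_iff)
  have pB: "(\<Prod>b\<in>Basis. g b) = (\<Prod>i\<in>UNIV. g (axis i 1))" for g :: "real ^ 'n::finite \<Rightarrow> real"
  proof -
    have "bij_betw (\<lambda>i::'n. axis i (1::real)) UNIV Basis"
      by (auto simp: bij_betw_def inj_on_def axis_eq_axis Basis_vec_def)
    from prod.reindex_bij_betw[OF this, of g] show ?thesis by (rule sym)
  qed
  have "reindex e -` box l u = box (reindex e' l) (reindex e' u)"
    using e by (auto simp: mem_box_cart reindex_def) metis+
  then have "emeasure (distr lborel borel (reindex e)) (box l u)
      = emeasure lborel (box (reindex e' l) (reindex e' u))"
    by (simp add: emeasure_distr[OF m])
  also have "\<dots> = (\<Prod>b\<in>Basis. (reindex e' u - reindex e' l) \<bullet> b)"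
    by (rule emeasure_lborel_box) (use le in \<open>auto simp: Basis_vec_def inner_axis reindex_def\<close>)
  also have "\<dots> = (\<Prod>j\<in>UNIV. u $ e' j - l $ e' j)"
    by (simp add: pB inner_axis reindex_def)
  also have "\<dots> = (\<Prod>i\<in>UNIV. u $ e' (e i) - l $ e' (e i))"
    by (rule arg_cong[where f = ennreal], rule prod.reindex_bij_betw[OF b, symmetric])
  finally show "emeasure (distr lborel borel (reindex e)) (box l u) = (\<Prod>b\<in>Basis. (u - l) \<bullet> b)"
    by (simp add: pB inner_axis e)
qed simp

lemma continuous_on_minor_sum:
  fixes A :: "'a::euclidean_space \<Rightarrow> 'b::euclidean_space \<Rightarrow> 'b"
  assumes "\<And>w. continuous_on S (\<lambda>x. A x w)"
  shows "continuous_on S (\<lambda>x. minor_sum (A x))"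
  unfolding minor_sum_def by (intro continuous_intros assms)

text \<open>The field is conjugated by a bijection with the well-ordered index type. Norms, inner
  products, derivatives, \<open>minor_sum\<close> and Lebesgue measure are all compatible with this,
  so hypotheses and conclusion carry over.\<close>

lemma minor_sum_integral_bound:
  fixes U :: "real ^ 'd \<Rightarrow> real ^ ('d::finite)" and A :: "real ^ 'd \<Rightarrow> real ^ 'd \<Rightarrow> real ^ 'd"
  assumes N: "CARD('d) = 2 * k" and r: "r > 0"
    and cont: "continuous_on UNIV U" and nrm: "\<And>x. norm (U x) = norm x"
    and orth: "\<And>x. U x \<bullet> x = 0"
    and der: "\<And>x. x \<noteq> 0 \<Longrightarrow> (U has_derivative A x) (at x)"
    and Acont: "\<And>w. continuous_on (- {0}) (\<lambda>x. A x w)"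
    and Abd: "\<And>x w. x \<noteq> 0 \<Longrightarrow> norm (A x w) \<le> K * norm w"
  shows "2 * real k * measure lborel (ball (0 :: real ^ 'd) r)
    \<le> (\<integral>x. minor_sum (A x) \<partial>restrict_space lborel (ball 0 r - {0}))"
proof -
  obtain e :: "'d \<Rightarrow> 'd idx" where "bij_betw e UNIV UNIV"
    using finite_same_card_bij[of "UNIV :: 'd set" "UNIV :: 'd idx set"] by auto
  define e' where "e' = inv_into UNIV e"
  have e: "e' (e i) = i" "e (e' j) = j" for i j
    using \<open>bij_betw e UNIV UNIV\<close> by (auto simp: e'_def bij_is_inj bij_is_surj surj_f_inv_f)
  have be: "bij e" "bij e'" using \<open>bij_betw e UNIV UNIV\<close> by (auto simp: e'_def bij_imp_bij_inv)
  define T T' where "T = reindex e" and "T' = reindex e'"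
  have T: "bounded_linear T" "bounded_linear T'" "\<And>x. norm (T x) = norm x" "\<And>x. norm (T' x) = norm x"
    "\<And>x. T (T' x) = x" "\<And>x. T' (T x) = x" "\<And>x y. T' x \<bullet> T' y = x \<bullet> y"
    by (simp_all add: T_def T'_def bounded_linear_reindex norm_reindex be reindex_reindex e inner_reindex)
  have Tc: "continuous_on X T" "continuous_on Y T'" for X Y
    by (auto intro: T linear_continuous_on)
  have T0: "T x = 0 \<longleftrightarrow> x = 0" for x by (metis T(3) norm_eq_zero)
  define U' A' where "U' y = T' (U (T y))" and "A' y w = T' (A (T y) (T w))" for y w
  have "2 * real k * measure lborel (ball (0 :: real ^ 'd idx) r)
    \<le> (\<integral>x. minor_sum (A' x) \<partial>restrict_space lborel (ball 0 r - {0}))"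
  proof (rule minor_sum_integral_bound_cart[OF _ r])
    show "CARD('d idx) = 2 * k" by (simp add: N)
    show "continuous_on UNIV U'"
      unfolding U'_def
      by (intro continuous_on_compose2[OF Tc(2)[of UNIV]] continuous_on_compose2[OF cont] Tc(1)) auto
    show "norm (U' x) = norm x" for x by (simp add: U'_def T nrm)
    show "U' x \<bullet> x = 0" for x
      using T(7)[of "U (T x)" "T x"] by (simp add: U'_def T orth)
    show "(U' has_derivative A' x) (at x)" if "x \<noteq> 0" for x
    proof -
      have "(T has_derivative T) (at x)" by (rule bounded_linear_imp_has_derivative[OF T(1)])
      from has_derivative_compose[OF this der[of "T x"]] that
      have "((\<lambda>y. U (T y)) has_derivative (\<lambda>w. A (T x) (T w))) (at x)" by (simp add: T0)
      from bounded_linear.has_derivative[OF T(2) this]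
      show ?thesis by (simp add: U'_def[abs_def] A'_def[abs_def])
    qed
    show "continuous_on (- {0}) (\<lambda>x. A' x w)" for w
      unfolding A'_def
      by (intro continuous_on_compose2[OF Tc(2)[of UNIV]] continuous_on_compose2[OF Acont] Tc(1))
        (auto simp: T0)
    show "norm (A' x w) \<le> K * norm w" if "x \<noteq> 0" for x w
      using Abd[of "T x" "T w"] that by (simp add: A'_def T T0)
  qed
  also have "(\<integral>x. minor_sum (A' x) \<partial>restrict_space lborel (ball 0 r - {0}))
      = (\<integral>y. indicator (ball 0 r - {0}) y *\<^sub>R minor_sum (A (T y)) \<partial>lborel)"
    unfolding A'_def[abs_def] T_def T'_def
    by (subst integral_restrict_space) (auto simp: minor_sum_reindex e)
  \<comment> \<open>The punctured ball is invariant under the isometry \<open>T\<close>, so the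
    whole integrand becomes a function of \<open>T y\<close> and the measure can be pushed
    forward.\<close>
  also have "\<dots> = (\<integral>y. indicator (ball 0 r - {0}) (T y) *\<^sub>R minor_sum (A (T y)) \<partial>lborel)"
    by (intro Bochner_Integration.integral_cong) (auto simp: indicator_def T T0)
  also have "\<dots> = (\<integral>x. indicator (ball 0 r - {0}) x *\<^sub>R minor_sum (A x) \<partial>distr lborel borel T)"
  proof (rule integral_distr[symmetric])
    show "T \<in> measurable lborel borel"
      using borel_measurable_continuous_onI[OF Tc(1)] by simp
    have "continuous_on (ball 0 r - {0}) (\<lambda>x. minor_sum (A x))"
      by (intro continuous_on_minor_sum continuous_on_subset[OF Acont]) auto
    then show "(\<lambda>x. indicator (ball 0 r - {0}) x *\<^sub>R minor_sum (A x)) \<in> borel_measurable borel"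
      by (intro borel_measurable_continuous_on_indicator) auto
  qed
  also have "distr lborel borel T = lborel"
    unfolding T_def by (rule lborel_distr_reindex[of e' e, OF e])
  also have "(\<integral>x. indicator (ball 0 r - {0}) x *\<^sub>R minor_sum (A x) \<partial>lborel)
      = (\<integral>x. minor_sum (A x) \<partial>restrict_space lborel (ball 0 r - {0}))"
    by (subst integral_restrict_space) auto
  also have "measure lborel (ball (0 :: real ^ 'd idx) r) = measure lborel (ball (0 :: real ^ 'd) r)"
  proof -
    have "measure lborel (ball (0 :: real ^ 'd) r) = measure (distr lborel borel T) (ball 0 r)"
      unfolding T_def by (simp add: lborel_distr_reindex[of e' e, OF e])
    also have "\<dots> = measure lborel (T -` ball 0 r)"
      using borel_measurable_continuous_onI[OF Tc(1)] by (simp add: measure_distr)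
    also have "T -` ball 0 r = ball 0 r" by (auto simp: T)
    finally show ?thesis by simp
  qed
  finally show ?thesis .
qed


subsection \<open>Pointwise comparison in an adapted orthonormal basis\<close>

text \<open>The trace of a bilinear form does not depend on the orthonormal basis: expand each
  \<open>c\<close> in the standard basis and sum over \<open>C\<close> first, where Parseval leaves
  only the diagonal terms.\<close>

lemma sum_Basis_eq_sum_orthonormal:
  fixes g :: "'a::euclidean_space \<Rightarrow> 'a \<Rightarrow> real"
  assumes g: "bilinear g" and C: "orthonormal_basis_of UNIV C"
  shows "(\<Sum>b\<in>Basis. g b b) = (\<Sum>c\<in>C. g c c)"
proof -
  have fin: "finite C"
    using C by (metis orthonormal_basis_of_def pairwise_orthogonal_imp_finite)
  \<comment> \<open>Polarised Parseval identity, obtained from the quadratic one at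
    \<open>w + z\<close>.\<close>
  have par: "(\<Sum>c\<in>C. (w \<bullet> c) * (z \<bullet> c)) = w \<bullet> z" for w z :: 'a
  proof -
    have "(\<Sum>c\<in>C. ((w + z) \<bullet> c)\<^sup>2) = (\<Sum>c\<in>C. (w \<bullet> c)\<^sup>2) + (\<Sum>c\<in>C. (z \<bullet> c)\<^sup>2) + 2 * (\<Sum>c\<in>C. (w \<bullet> c) * (z \<bullet> c))"
      by (simp add: inner_add_left power2_eq_square algebra_simps sum.distrib sum_distrib_left)
    then have "(w + z) \<bullet> (w + z) = w \<bullet> w + z \<bullet> z + 2 * (\<Sum>c\<in>C. (w \<bullet> c) * (z \<bullet> c))"
      by (simp only: orthonormal_basis_of_parseval[OF C] UNIV_I)
    then show ?thesis by (simp add: inner_add_left inner_add_right inner_commute)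
  qed
  have ex: "g c c = (\<Sum>a\<in>Basis. \<Sum>b\<in>Basis. (a \<bullet> c) * (b \<bullet> c) * g a b)" for c
  proof -
    have "g c c = g (\<Sum>a\<in>Basis. (c \<bullet> a) *\<^sub>R a) (\<Sum>b\<in>Basis. (c \<bullet> b) *\<^sub>R b)"
      by (simp add: euclidean_representation)
    also have "\<dots> = (\<Sum>(a, b)\<in>Basis \<times> Basis. g ((c \<bullet> a) *\<^sub>R a) ((c \<bullet> b) *\<^sub>R b))"
      by (rule bilinear_sum[OF g])
    also have "\<dots> = (\<Sum>a\<in>Basis. \<Sum>b\<in>Basis. (a \<bullet> c) * (b \<bullet> c) * g a b)"
      by (simp add: sum.cartesian_product bilinear_lmul[OF g] bilinear_rmul[OF g] inner_commute ac_simps)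
    finally show ?thesis .
  qed
  have "(\<Sum>c\<in>C. g c c) = (\<Sum>a\<in>Basis. \<Sum>c\<in>C. \<Sum>b\<in>Basis. (a \<bullet> c) * (b \<bullet> c) * g a b)"
    by (simp only: ex) (rule sum.swap)
  also have "\<dots> = (\<Sum>a\<in>Basis. \<Sum>b\<in>Basis. \<Sum>c\<in>C. (a \<bullet> c) * (b \<bullet> c) * g a b)"
    by (rule sum.cong[OF refl], rule sum.swap)
  also have "\<dots> = (\<Sum>a\<in>Basis. \<Sum>b\<in>Basis. (a \<bullet> b) * g a b)"
    by (simp add: par flip: sum_distrib_right)
  also have "\<dots> = (\<Sum>a\<in>Basis. \<Sum>b\<in>Basis. if b = a then g a a else 0)"
    by (intro sum.cong refl) (auto simp: inner_Basis)
  finally show ?thesis by simp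
qed

definition frobenius_sq :: "('a::euclidean_space \<Rightarrow> 'a) \<Rightarrow> real" where
  "frobenius_sq L = (\<Sum>b\<in>Basis. L b \<bullet> L b)"

lemma frobenius_sq_orthonormal:
  assumes L: "linear L" and C: "orthonormal_basis_of UNIV C"
  shows "frobenius_sq L = (\<Sum>c\<in>C. \<Sum>d\<in>C. (L c \<bullet> d)\<^sup>2)"
proof -
  have "bilinear (\<lambda>x y. L x \<bullet> L y)"
    using L by (auto simp: bilinear_def linear_iff inner_add_left inner_add_right)
  from sum_Basis_eq_sum_orthonormal[OF this C] show ?thesis
    by (simp add: frobenius_sq_def orthonormal_basis_of_parseval[OF C])
qed

lemma minor_sum_orthonormal:
  assumes L: "linear L" and C: "orthonormal_basis_of UNIV C"
  shows "minor_sum L = (\<Sum>c\<in>C. \<Sum>d\<in>C. (L c \<bullet> c) * (L d \<bullet> d) - (L c \<bullet> d) * (L d \<bullet> c))"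
proof -
  have tr: "bilinear (\<lambda>x y. L x \<bullet> y)"
    using L by (auto simp: bilinear_def linear_iff inner_add_left inner_add_right)
  \<comment> \<open>With \<open>z\<close> fixed, the product of the two entries is bilinear in the
    other vector, so the bases of the double sum are exchanged one at a time.\<close>
  have b1: "bilinear (\<lambda>x y. (L z \<bullet> x) * (L y \<bullet> z))" for z
    using L by (auto simp: bilinear_def linear_iff inner_add_left inner_add_right algebra_simps)
  have "(\<Sum>b\<in>Basis. \<Sum>c\<in>Basis. (L b \<bullet> c) * (L c \<bullet> b)) = (\<Sum>b\<in>Basis. \<Sum>c\<in>C. (L b \<bullet> c) * (L c \<bullet> b))"
    by (rule sum.cong[OF refl], rule sum_Basis_eq_sum_orthonormal[OF b1 C])
  also have "\<dots> = (\<Sum>c\<in>C. \<Sum>b\<in>Basis. (L c \<bullet> b) * (L b \<bullet> c))"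
    by (subst sum.swap) (simp add: mult.commute)
  also have "\<dots> = (\<Sum>c\<in>C. \<Sum>d\<in>C. (L c \<bullet> d) * (L d \<bullet> c))"
    by (rule sum.cong[OF refl], rule sum_Basis_eq_sum_orthonormal[OF b1 C])
  finally have "(\<Sum>b\<in>Basis. \<Sum>c\<in>Basis. (L b \<bullet> c) * (L c \<bullet> b)) = (\<Sum>c\<in>C. \<Sum>d\<in>C. (L c \<bullet> d) * (L d \<bullet> c))" .
  then show ?thesis
    by (simp add: minor_sum_def sum_subtractf sum_Basis_eq_sum_orthonormal[OF tr C] flip: sum_product)
qed

text \<open>Cauchy-Schwarz bounds the squared trace by \<open>card C\<close> times the sum
  \<open>D\<close> of squared diagonal entries. The mixed products contribute at most
  \<open>Q - 2 * D\<close>, where \<open>Q\<close> sums all squares. Finally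
  \<open>D \<le> Q\<close> is used with the coefficient \<open>card C - 2\<close>, nonnegative by
  hypothesis.\<close>

lemma minors_le_sum_squares:
  fixes m :: "'b \<Rightarrow> 'b \<Rightarrow> real"
  assumes fin: "finite C" and card: "card C \<ge> 2"
  shows "(\<Sum>c\<in>C. \<Sum>d\<in>C. m c c * m d d - m c d * m d c)
    \<le> (real (card C) - 1) * (\<Sum>c\<in>C. \<Sum>d\<in>C. (m c d)\<^sup>2)"
proof -
  define D where "D = (\<Sum>c\<in>C. (m c c)\<^sup>2)"
  define Q where "Q = (\<Sum>c\<in>C. \<Sum>d\<in>C. (m c d)\<^sup>2)"
  have DQ: "D \<le> Q"
    unfolding D_def Q_def
  proof (rule sum_mono)
    fix c assume "c \<in> C"
    then show "(m c c)\<^sup>2 \<le> (\<Sum>d\<in>C. (m c d)\<^sup>2)"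
      using fin by (intro member_le_sum) auto
  qed
  \<comment> \<open>Off the diagonal this is the arithmetic-geometric mean inequality; on the
    diagonal the correction makes it an equality.\<close>
  have "(\<Sum>c\<in>C. \<Sum>d\<in>C. - (m c d * m d c))
      \<le> (\<Sum>c\<in>C. \<Sum>d\<in>C. (m c d)\<^sup>2 / 2 + (m d c)\<^sup>2 / 2 - (if d = c then 2 * (m c c)\<^sup>2 else 0))"
  proof (intro sum_mono)
    fix c d
    show "- (m c d * m d c) \<le> (m c d)\<^sup>2 / 2 + (m d c)\<^sup>2 / 2 - (if d = c then 2 * (m c c)\<^sup>2 else 0)"
      using zero_le_power2[of "m c d + m d c"] by (auto simp: power2_eq_square algebra_simps)
  qed
  also have "\<dots> = (\<Sum>c\<in>C. \<Sum>d\<in>C. (m c d)\<^sup>2 / 2) + (\<Sum>c\<in>C. \<Sum>d\<in>C. (m d c)\<^sup>2 / 2) - 2 * D"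
    using fin by (simp add: sum.distrib sum_subtractf D_def sum_distrib_left)
  also have "(\<Sum>c\<in>C. \<Sum>d\<in>C. (m d c)\<^sup>2 / 2) = (\<Sum>c\<in>C. \<Sum>d\<in>C. (m c d)\<^sup>2 / 2)"
    by (rule sum.swap)
  also have "(\<Sum>c\<in>C. \<Sum>d\<in>C. (m c d)\<^sup>2 / 2) = Q / 2"
    by (simp add: Q_def sum_divide_distrib)
  finally have "(\<Sum>c\<in>C. \<Sum>d\<in>C. - (m c d * m d c)) \<le> Q - 2 * D" by simp
  moreover have "(\<Sum>c\<in>C. \<Sum>d\<in>C. m c c * m d d) \<le> real (card C) * D"
    using sum_squared_le_sum_of_squares[of "\<lambda>c. m c c" C]
    by (simp add: D_def power2_eq_square sum_product mult.commute)
  ultimately have "(\<Sum>c\<in>C. \<Sum>d\<in>C. m c c * m d d - m c d * m d c) \<le> (real (card C) - 2) * D + Q"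
    by (simp add: sum_subtractf sum_negf algebra_simps)
  also have "\<dots> \<le> (real (card C) - 2) * Q + Q"
    using DQ card by (intro add_right_mono mult_left_mono) auto
  finally show ?thesis by (simp add: Q_def algebra_simps)
qed

text \<open>An orthonormal basis of the complement of the plane of \<open>u\<close> and
  \<open>v\<close> is completed by \<open>v\<close>, then by \<open>u\<close>. A single basis thus
  serves the tangent space and the ambient space.\<close>

lemma orthonormal_basis_extending:
  fixes u v :: "'a::euclidean_space"
  assumes u: "norm u = 1" and v: "norm v = 1" and uv: "u \<bullet> v = 0"
  obtains B where "finite B" "u \<notin> B" "v \<notin> B" "card B + 2 = DIM('a)"
    "\<And>b. b \<in> B \<Longrightarrow> u \<bullet> b = 0 \<and> v \<bullet> b = 0"
    "orthonormal_basis_of {x. u \<bullet> x = 0} (insert v B)"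
    "orthonormal_basis_of UNIV (insert u (insert v B))"
proof -
  let ?T = "{x. u \<bullet> x = 0} \<inter> {x. v \<bullet> x = 0}"
  have "subspace ?T" by (intro subspace_inter subspace_hyperplane)
  then obtain B where B: "B \<subseteq> ?T" "pairwise orthogonal B" "\<And>x. x \<in> B \<Longrightarrow> norm x = 1"
    "independent B" "card B = dim ?T" "span B = ?T"
    by (rule orthonormal_basis_subspace) blast
  have fin: "finite B" using B(4) by (rule independent_imp_finite)
  have uu: "u \<bullet> u = 1" "v \<bullet> v = 1" using u v by (simp_all add: dot_square_norm)
  have perp: "u \<bullet> b = 0" "v \<bullet> b = 0" if "b \<in> B" for b using B(1) that by auto
  have nin: "u \<notin> B" "v \<notin> B" "u \<noteq> v" using perp uu uv by fastforce+
  have pv: "pairwise orthogonal (insert v B)"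
    using B(2) perp by (auto simp: pairwise_insert orthogonal_def inner_commute)
  then have pu: "pairwise orthogonal (insert u (insert v B))"
    using perp uv by (auto simp: pairwise_insert orthogonal_def inner_commute)
  have spv: "span (insert v B) = {x. u \<bullet> x = 0}"
  proof
    have "insert v B \<subseteq> {x. u \<bullet> x = 0}" using perp uv by auto
    then show "span (insert v B) \<subseteq> {x. u \<bullet> x = 0}"
      by (rule span_minimal[OF _ subspace_hyperplane])
    show "{x. u \<bullet> x = 0} \<subseteq> span (insert v B)"
    proof
      fix x assume x: "x \<in> {x. u \<bullet> x = 0}"
      have "x - (v \<bullet> x) *\<^sub>R v \<in> span B"
        using x uv uu by (simp add: B(6) inner_diff_right)
      then show "x \<in> span (insert v B)" by (auto simp: span_insert)
    qed
  qed
  have spu: "span (insert u (insert v B)) = UNIV"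
  proof -
    have "x - (u \<bullet> x) *\<^sub>R u \<in> span (insert v B)" for x
      using uu by (simp add: spv inner_diff_right)
    then show ?thesis by (auto simp: span_insert[of u])
  qed
  have "0 \<notin> insert u (insert v B)" using B(3) u v by force
  then have "independent (insert u (insert v B))"
    using pu pairwise_orthogonal_independent by blast
  then have "card (insert u (insert v B)) = DIM('a)"
    using spu by (metis dim_UNIV dim_eq_card_independent dim_span)
  then have "card B + 2 = DIM('a)" using nin fin by simp
  then show ?thesis
    using that[OF fin nin(1,2)] perp pv pu spv spu B(3) u v
    unfolding orthonormal_basis_of_def by auto
qed

text \<open>
  In the application \<open>u = x / \<bar>x\<bar>\<close>, \<open>v = U x / \<bar>x\<bar>\<close> and \<open>L = DU x\<close> for a field \<open>U\<close> homogeneous of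
  degree 1 with \<open>\<bar>U x\<bar> = \<bar>x\<bar>\<close> and \<open>U x \<bullet> x = 0\<close>; the hypotheses on \<open>L\<close> are Euler's relation and the
  derivatives of these two identities.
\<close>

lemma minor_sum_le_frobenius_sq:
  fixes L :: "'a::euclidean_space \<Rightarrow> 'a"
  assumes L: "linear L" and u: "norm u = 1" and v: "norm v = 1" and uv: "u \<bullet> v = 0"
    and Lu: "L u = v" "\<And>w. L w \<bullet> u = - (v \<bullet> w)" and Lv: "\<And>w. L w \<bullet> v = u \<bullet> w"
    and dim: "DIM('a) = 2 * n + 2" "n \<ge> 1"
  obtains C where "orthonormal_basis_of {x. u \<bullet> x = 0} C"
    "(\<Sum>a\<in>C. \<Sum>b\<in>C. (L b \<bullet> a)\<^sup>2) = frobenius_sq L - 2"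
    "minor_sum L - 2 \<le> (2 * real n - 1) * (frobenius_sq L - 2)"
proof -
  obtain B where fin: "finite B" and nin: "u \<notin> B" "v \<notin> B" and card: "card B + 2 = DIM('a)"
    and perp: "\<And>b. b \<in> B \<Longrightarrow> u \<bullet> b = 0 \<and> v \<bullet> b = 0"
    and T: "orthonormal_basis_of {x. u \<bullet> x = 0} (insert v B)"
    and C: "orthonormal_basis_of UNIV (insert u (insert v B))"
    using orthonormal_basis_extending[OF u v uv] by blast
  have cB: "real (card B) = 2 * real n" "card B \<ge> 2" using card dim by auto
  have uu: "u \<bullet> u = 1" "v \<bullet> v = 1" "v \<bullet> u = 0"
    using u v uv by (simp_all add: dot_square_norm inner_commute)
  have nuv: "u \<noteq> v" using uu by auto
  note sums = fin nin nuv sum.insert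
  define m where "m c d = L c \<bullet> d" for c d
  \<comment> \<open>On the plane of \<open>u\<close> and \<open>v\<close> the matrix is a quarter
    turn, which contributes exactly 2 to \<open>frobenius_sq\<close> and 2 to
    \<open>minor_sum\<close>.\<close>
  have m: "m u u = 0" "m u v = 1" "m v u = - 1" "m v v = 0"
    by (simp_all add: m_def Lu(2) Lv uv uu)
  have mB: "m b u = 0" "m b v = 0" "m u b = 0" if "b \<in> B" for b
    using perp[OF that] by (simp_all add: m_def Lu Lv)
  define Q where "Q = (\<Sum>c\<in>B. \<Sum>d\<in>B. (m c d)\<^sup>2)"
  \<comment> \<open>The entries \<open>m v d\<close> are unconstrained. They count in the Frobenius
    norm, but in the minors each is multiplied by \<open>m d v = 0\<close>; so only the block on
    \<open>B\<close> matters there.\<close>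
  define P where "P = (\<Sum>d\<in>B. (m v d)\<^sup>2)"
  have P: "P \<ge> 0" by (simp add: P_def sum_nonneg)
  have fr: "frobenius_sq L = Q + P + 2"
    unfolding frobenius_sq_orthonormal[OF L C]
    by (simp add: sums m mB Q_def P_def flip: m_def)
  have mi: "minor_sum L = (\<Sum>c\<in>B. \<Sum>d\<in>B. m c c * m d d - m c d * m d c) + 2"
    unfolding minor_sum_orthonormal[OF L C]
    by (simp add: sums m mB flip: m_def)
  have "(\<Sum>a\<in>insert v B. \<Sum>b\<in>insert v B. (m b a)\<^sup>2) = (\<Sum>a\<in>B. \<Sum>b\<in>B. (m b a)\<^sup>2) + P"
    by (simp add: sums m mB P_def sum.distrib)
  also have "(\<Sum>a\<in>B. \<Sum>b\<in>B. (m b a)\<^sup>2) = Q" unfolding Q_def by (rule sum.swap)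
  finally have na: "(\<Sum>a\<in>insert v B. \<Sum>b\<in>insert v B. (L b \<bullet> a)\<^sup>2) = frobenius_sq L - 2"
    by (simp add: fr m_def)
  have "minor_sum L - 2 \<le> (2 * real n - 1) * Q"
    using minors_le_sum_squares[OF fin cB(2), of m] by (simp add: mi Q_def cB(1))
  also have "\<dots> \<le> (2 * real n - 1) * (Q + P)"
    using P dim by (intro mult_left_mono) auto
  finally have "minor_sum L - 2 \<le> (2 * real n - 1) * (frobenius_sq L - 2)" by (simp add: fr)
  with T na show ?thesis by (rule that)
qed


subsection \<open>The homogeneous extension of a field on the sphere\<close>

text \<open>Reduces smoothness on the sphere to a continuously differentiable extension near
  \<open>y\<close>, whose derivative yields the intrinsic differential on tangent vectors.\<close>

lemma smooth_map_on_sphere_local_extension: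
  fixes v :: "'a::euclidean_space \<Rightarrow> 'b::real_normed_vector"
  assumes v: "smooth_map_on (sphere 0 r) v" and r: "r > 0" and y: "y \<in> sphere 0 r"
  obtains W F D where "open W" "y \<in> W" "\<And>z. z \<in> W \<Longrightarrow> (F has_derivative D z) (at z)"
    "\<And>w. continuous_on W (\<lambda>z. D z w)" "\<And>z. z \<in> W \<inter> sphere 0 r \<Longrightarrow> F z = v z"
    "\<And>z X. z \<in> W \<inter> sphere 0 r \<Longrightarrow> X \<in> sphere_tangent z \<Longrightarrow> sphere_differential v z X = D z X"
proof -
  obtain W F where W: "open W" "y \<in> W" "smooth_on W F" and F: "\<And>z. z \<in> W \<inter> sphere 0 r \<Longrightarrow> F z = v z"
  proof -
    from v y have "\<exists>U F. open U \<and> y \<in> U \<and> smooth_on U F \<and> (\<forall>z\<in>U \<inter> sphere 0 r. F z = v z)"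
      unfolding smooth_map_on_def by (rule bspec)
    then show ?thesis by (elim exE conjE) (rule that, assumption, assumption, assumption, erule bspec)
  qed
  have "Ck_on (Suc 0) W F" using W(3) by (simp only: smooth_on_def)
  then have d: "\<And>z. z \<in> W \<Longrightarrow> F differentiable (at z)"
    and c: "\<And>w. continuous_on W (\<lambda>z. frechet_derivative F (at z) w)"
    by auto
  have D: "(F has_derivative frechet_derivative F (at z)) (at z)" if "z \<in> W" for z
    using d[OF that] by (simp add: frechet_derivative_works)
  have "sphere_differential v z X = frechet_derivative F (at z) X"
    if "z \<in> W \<inter> sphere 0 r" "X \<in> sphere_tangent z" for z X
    using that r F by (intro sphere_differential_eq[OF _ _ D W(1)]) auto
  then show ?thesis by (intro that[OF W(1,2) D c F])
qed

text \<open>The factor \<open>norm x\<close> makes the field homogeneous of degree 1, so its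
  derivative is constant along rays. Its value at the origin is 0, and on the sphere of radius
  \<open>r\<close> it is \<open>r\<close> times \<open>v\<close>.\<close>

definition homogeneous_extension :: "real \<Rightarrow> ('a::euclidean_space \<Rightarrow> 'a) \<Rightarrow> 'a \<Rightarrow> 'a" where
  "homogeneous_extension r v x = norm x *\<^sub>R v ((r / norm x) *\<^sub>R x)"

text \<open>The product rule: the first term differentiates the norm, the second the field along the
  radial projection, whose factor \<open>r / norm x\<close> meets \<open>norm x\<close> and leaves
  \<open>r\<close>. The differential of \<open>v\<close> is applied to a tangent vector
  only.\<close>

definition extension_deriv :: "real \<Rightarrow> ('a::euclidean_space \<Rightarrow> 'a) \<Rightarrow> 'a \<Rightarrow> 'a \<Rightarrow> 'a" where
  "extension_deriv r v x w = (sgn x \<bullet> w) *\<^sub>R v ((r / norm x) *\<^sub>R x)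
     + r *\<^sub>R sphere_differential v ((r / norm x) *\<^sub>R x) (w - (sgn x \<bullet> w) *\<^sub>R sgn x)"

lemma radial_projection_in_sphere: "r > 0 \<Longrightarrow> x \<noteq> 0 \<Longrightarrow> (r / norm x) *\<^sub>R x \<in> sphere 0 r"
  by simp

lemma perp_projection_in_sphere_tangent:
  "w - (sgn x \<bullet> w) *\<^sub>R sgn x \<in> sphere_tangent (c *\<^sub>R x)"
proof (cases "x = 0")
  case False
  then have "x \<bullet> sgn x = norm x" "sgn x \<bullet> w * norm x = x \<bullet> w"
    by (simp_all add: sgn_div_norm power2_norm_eq_inner[symmetric] power2_eq_square)
  then show ?thesis by (simp add: sphere_tangent_def inner_diff_right)
qed (simp add: sphere_tangent_def)

text \<open>The derivative of a field homogeneous of degree 1 has degree 0. Hence bounds and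
  integrands on the punctured ball can be read off from the sphere.\<close>

lemma extension_deriv_radial:
  assumes "r > 0" "x \<noteq> 0"
  shows "extension_deriv r v ((r / norm x) *\<^sub>R x) = extension_deriv r v x"
proof -
  have "sgn ((r / norm x) *\<^sub>R x) = sgn x"
    using assms by (simp add: sgn_scaleR)
  then show ?thesis using assms by (simp add: extension_deriv_def fun_eq_iff)
qed

lemma has_derivative_radial_projection:
  fixes x :: "'a::euclidean_space"
  assumes "x \<noteq> 0"
  shows "((\<lambda>x. (r / norm x) *\<^sub>R x) has_derivative (\<lambda>w. (r / norm x) *\<^sub>R (w - (sgn x \<bullet> w) *\<^sub>R sgn x))) (at x)"
proof -
  have n: "(norm has_derivative (\<lambda>w. sgn x \<bullet> w)) (at x)"
    using has_derivative_norm[OF assms] by (simp add: inner_commute)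
  show ?thesis
    by (rule derivative_eq_intros n refl assms | simp add: assms)+
      (use assms in \<open>auto simp: fun_eq_iff sgn_div_norm scaleR_diff_right power2_eq_square divide_simps\<close>)
qed

lemma has_derivative_homogeneous_extension:
  fixes v :: "'a::euclidean_space \<Rightarrow> 'a"
  assumes v: "smooth_map_on (sphere 0 r) v" and r: "r > 0" and x: "x \<noteq> 0"
  shows "(homogeneous_extension r v has_derivative extension_deriv r v x) (at x)"
proof -
  let ?p = "\<lambda>x::'a. (r / norm x) *\<^sub>R x"
  obtain W F D where W: "open W" "?p x \<in> W" "\<And>z. z \<in> W \<Longrightarrow> (F has_derivative D z) (at z)"
    and F: "\<And>z. z \<in> W \<inter> sphere 0 r \<Longrightarrow> F z = v z"
    "\<And>z X. z \<in> W \<inter> sphere 0 r \<Longrightarrow> X \<in> sphere_tangent z \<Longrightarrow> sphere_differential v z X = D z X"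
    using smooth_map_on_sphere_local_extension[OF v r radial_projection_in_sphere[OF r x]] by metis
  have n: "(norm has_derivative (\<lambda>w. sgn x \<bullet> w)) (at x)"
    using has_derivative_norm[OF x] by (simp add: inner_commute)
  let ?P = "\<lambda>w. w - (sgn x \<bullet> w) *\<^sub>R sgn x"
  have lin: "linear (D (?p x))" using W(3)[OF W(2)] has_derivative_linear by blast
  have Fp: "((\<lambda>x. F (?p x)) has_derivative (\<lambda>w. D (?p x) ((r / norm x) *\<^sub>R ?P w))) (at x)"
    by (rule has_derivative_compose[OF has_derivative_radial_projection[OF x] W(3)[OF W(2)]])
  have px: "?p x \<in> W \<inter> sphere 0 r" using W(2) radial_projection_in_sphere[OF r x] by blast
  have "((\<lambda>x. norm x *\<^sub>R F (?p x)) has_derivative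
      (\<lambda>w. norm x *\<^sub>R D (?p x) ((r / norm x) *\<^sub>R ?P w) + (sgn x \<bullet> w) *\<^sub>R F (?p x))) (at x)"
    by (rule has_derivative_scaleR[OF n Fp])
  also have "(\<lambda>w. norm x *\<^sub>R D (?p x) ((r / norm x) *\<^sub>R ?P w) + (sgn x \<bullet> w) *\<^sub>R F (?p x))
      = extension_deriv r v x"
    using x by (simp add: fun_eq_iff extension_deriv_def linear_scale[OF lin] F(1)[OF px]
        F(2)[OF px perp_projection_in_sphere_tangent])
  finally have D: "((\<lambda>x. norm x *\<^sub>R F (?p x)) has_derivative extension_deriv r v x) (at x)" .
  \<comment> \<open>The open cone of points whose radial projection lies in \<open>W\<close>; there
    the local extension \<open>F\<close> may be replaced by \<open>v\<close>.\<close>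
  define N where "N = {z \<in> - {0}. ?p z \<in> W}"
  have "continuous_on (- {0}) ?p" by (intro continuous_intros) auto
  then have "open (- {0} \<inter> ?p -` W)"
    by (rule continuous_open_preimage) (simp_all add: W(1) open_Compl)
  moreover have "- {0} \<inter> ?p -` W = N" by (auto simp: N_def)
  ultimately have N: "open N" by simp
  show ?thesis
  proof (rule has_derivative_transform_within_open[OF D N])
    show "x \<in> N" using x W(2) by (simp add: N_def)
    show "norm z *\<^sub>R F (?p z) = homogeneous_extension r v z" if "z \<in> N" for z
      using that F(1)[of "?p z"] r by (simp add: N_def homogeneous_extension_def)
  qed
qed

lemma continuous_on_extension_deriv:
  fixes v :: "'a::euclidean_space \<Rightarrow> 'a"
  assumes v: "smooth_map_on (sphere 0 r) v" and r: "r > 0"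
  shows "continuous_on (- {0}) (\<lambda>x. extension_deriv r v x w)"
proof -
  let ?p = "\<lambda>x::'a. (r / norm x) *\<^sub>R x"
  have "isCont (\<lambda>x. extension_deriv r v x w) x" if x: "x \<noteq> 0" for x
  proof -
    obtain W F D where W: "open W" "?p x \<in> W" "\<And>z. z \<in> W \<Longrightarrow> (F has_derivative D z) (at z)"
      "\<And>w. continuous_on W (\<lambda>z. D z w)"
      and F: "\<And>z. z \<in> W \<inter> sphere 0 r \<Longrightarrow> F z = v z"
      "\<And>z X. z \<in> W \<inter> sphere 0 r \<Longrightarrow> X \<in> sphere_tangent z \<Longrightarrow> sphere_differential v z X = D z X"
      using smooth_map_on_sphere_local_extension[OF v r radial_projection_in_sphere[OF r x]] by metis
    define N where "N = {z \<in> - {0}. ?p z \<in> W}"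
    have pc: "continuous_on (- {0}) ?p" by (intro continuous_intros) auto
    then have "open (- {0} \<inter> ?p -` W)"
      by (rule continuous_open_preimage) (simp_all add: W(1) open_Compl)
    moreover have "- {0} \<inter> ?p -` W = N" by (auto simp: N_def)
    ultimately have N: "open N" by simp
    have N0: "N \<subseteq> - {0}" "?p ` N \<subseteq> W" by (auto simp: N_def)
    have Fc: "continuous_on W F"
      using W(3) by (intro has_derivative_continuous_on) (auto intro: has_derivative_at_withinI)
    have sc: "continuous_on N sgn" using N0 by (auto simp: sgn_div_norm[abs_def] intro!: continuous_intros)
    have comp: "continuous_on N (\<lambda>z. g (?p z))" if "continuous_on W g" for g :: "'a \<Rightarrow> 'a"
      by (rule continuous_on_compose2[OF that continuous_on_subset[OF pc N0(1)] N0(2)])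
    \<comment> \<open>Continuity of \<open>D\<close> in the base point is known for a fixed vector
      only, so the vector, which varies with \<open>z\<close>, is expanded in the standard
      basis.\<close>
    have eq: "extension_deriv r v z w = (sgn z \<bullet> w) *\<^sub>R F (?p z)
        + r *\<^sub>R (\<Sum>b\<in>Basis. ((w - (sgn z \<bullet> w) *\<^sub>R sgn z) \<bullet> b) *\<^sub>R D (?p z) b)" if "z \<in> N" for z
    proof -
      have pz: "?p z \<in> W \<inter> sphere 0 r" using that r by (auto simp: N_def)
      then have lin: "linear (D (?p z))" using W(3) has_derivative_linear by blast
      have rep: "D (?p z) X = (\<Sum>b\<in>Basis. (X \<bullet> b) *\<^sub>R D (?p z) b)" for X
      proof -
        have "D (?p z) X = D (?p z) (\<Sum>b\<in>Basis. (X \<bullet> b) *\<^sub>R b)"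
          by (simp only: euclidean_representation)
        then show ?thesis by (simp only: linear_sum[OF lin] linear_scale[OF lin])
      qed
      show ?thesis
        unfolding extension_deriv_def F(1)[OF pz] F(2)[OF pz perp_projection_in_sphere_tangent]
          rep[symmetric] ..
    qed
    have "continuous_on N (\<lambda>z. (sgn z \<bullet> w) *\<^sub>R F (?p z)
        + r *\<^sub>R (\<Sum>b\<in>Basis. ((w - (sgn z \<bullet> w) *\<^sub>R sgn z) \<bullet> b) *\<^sub>R D (?p z) b))"
      by (intro continuous_intros sc comp[OF Fc] comp[OF W(4)])
    then have "continuous_on N (\<lambda>x. extension_deriv r v x w)"
      by (rule continuous_on_eq) (simp add: eq)
    moreover have "x \<in> N" using x W(2) by (simp add: N_def)
    ultimately show ?thesis using N by (simp add: continuous_on_eq_continuous_at)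
  qed
  then show ?thesis by (simp add: continuous_on_eq_continuous_at open_Compl)
qed

text \<open>A function constant along rays takes all its values on the sphere, which is
  compact.\<close>

lemma radial_function_bounded:
  fixes h :: "'a::euclidean_space \<Rightarrow> real"
  assumes h: "continuous_on (- {0}) h" and r: "r > 0"
    and inv: "\<And>x. x \<noteq> 0 \<Longrightarrow> h ((r / norm x) *\<^sub>R x) = h x"
  shows "\<exists>K\<ge>0. \<forall>x. x \<noteq> 0 \<longrightarrow> \<bar>h x\<bar> \<le> K"
proof -
  have "compact (h ` sphere 0 r)"
    using r by (intro compact_continuous_image continuous_on_subset[OF h]) auto
  then obtain K where K: "\<And>y. y \<in> sphere 0 r \<Longrightarrow> \<bar>h y\<bar> \<le> K"
    using compact_imp_bounded bounded_real by (metis imageI)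
  have "\<bar>h x\<bar> \<le> \<bar>K\<bar>" if "x \<noteq> 0" for x
    using K[OF radial_projection_in_sphere[OF r that]] inv[OF that] by simp
  then show ?thesis by (intro exI[of _ "\<bar>K\<bar>"]) auto
qed

section \<open>Integrals over the sphere as integrals over the punctured ball\<close>

lemma integral_scale_measure:
  fixes g :: "'a \<Rightarrow> real"
  assumes "g \<in> borel_measurable M" "c \<ge> 0"
  shows "(\<integral>x. g x \<partial>scale_measure (ennreal c) M) = c * (\<integral>x. g x \<partial>M)"
proof -
  have "scale_measure (ennreal c) M = density M (\<lambda>_. ennreal c)"
    by (rule measure_eqI) (auto simp: emeasure_density nn_integral_cmult_indicator)
  then show ?thesis using assms by (simp add: integral_density)
qed

text \<open>The sphere carries a scaled image of Lebesgue measure under radial projection, so a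
  function is integrated by extending it constantly along rays.\<close>

lemma integral_sphere_measure:
  fixes g :: "'a::euclidean_space \<Rightarrow> real"
  assumes r: "r > 0" and g: "g \<in> borel_measurable (restrict_space borel (sphere 0 r))"
  shows "(\<integral>x. g x \<partial>sphere_measure r)
    = real DIM('a) / r * (\<integral>x. g ((r / norm x) *\<^sub>R x) \<partial>restrict_space lborel (ball 0 r - {0}))"
proof -
  let ?p = "\<lambda>x::'a. (r / norm x) *\<^sub>R x"
  let ?N = "restrict_space lborel (ball (0::'a) r - {0})"
  have "?p \<in> borel_measurable (restrict_space borel (ball 0 r - {0}))"
    by (rule borel_measurable_continuous_on_restrict) (auto intro!: continuous_intros)
  then have "?p \<in> borel_measurable ?N"
    by (subst measurable_cong_sets[OF sets_restrict_space_cong[OF sets_lborel] refl])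
  then have p: "?p \<in> measurable ?N (restrict_space borel (sphere 0 r))"
    using r by (intro measurable_restrict_space2) (auto simp: space_restrict_space)
  show ?thesis
    unfolding sphere_measure_def using r g
    by (subst integral_scale_measure) (auto simp: integral_distr[OF p g])
qed

section \<open>The extension of a unit field: first-order identities and energy density\<close>

context
  fixes v :: "'a::euclidean_space \<Rightarrow> 'a" and r :: real
  assumes v: "unit_vector_field r v" and r: "r > 0"
begin

private abbreviation "U \<equiv> homogeneous_extension r v"
private abbreviation "A \<equiv> extension_deriv r v"

lemma smooth_v: "smooth_map_on (sphere 0 r) v"
  using v by (simp add: unit_vector_field_def)

lemma v_props: "y \<in> sphere 0 r \<Longrightarrow> y \<bullet> v y = 0 \<and> norm (v y) = 1"
  using v by (simp add: unit_vector_field_def sphere_tangent_def)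

lemma norm_homogeneous_extension: "norm (U x) = norm x"
  using v_props[OF radial_projection_in_sphere[OF r]]
  by (cases "x = 0") (simp_all add: homogeneous_extension_def)

lemma homogeneous_extension_orthogonal: "U x \<bullet> x = 0"
proof (cases "x = 0")
  case False
  have "((r / norm x) *\<^sub>R x) \<bullet> v ((r / norm x) *\<^sub>R x) = 0"
    using v_props[OF radial_projection_in_sphere[OF r False]] by blast
  then show ?thesis using False r by (simp add: homogeneous_extension_def inner_commute)
qed simp

lemmas has_derivative_extension = has_derivative_homogeneous_extension[OF smooth_v r]

lemma continuous_homogeneous_extension: "continuous_on UNIV U"
proof -
  have "isCont U x" for x
  proof (cases "x = 0")
    case True
    \<comment> \<open>At the origin continuity comes from the norm identity alone.\<close>
    have "U \<midarrow>0\<rightarrow> 0"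
      by (rule tendsto_norm_zero_cancel)
        (use tendsto_norm_zero[OF tendsto_ident_at[of "0::'a"]] in \<open>simp add: norm_homogeneous_extension\<close>)
    then show ?thesis
      using norm_homogeneous_extension[of 0] True by (simp add: isCont_def)
  next
    case False
    then show ?thesis using has_derivative_continuous[OF has_derivative_extension] by blast
  qed
  then show ?thesis by (simp add: continuous_on_eq_continuous_at)
qed

lemma linear_extension_deriv: "x \<noteq> 0 \<Longrightarrow> linear (A x)"
  using has_derivative_extension has_derivative_linear by blast

text \<open>Derivative of the orthogonality relation between \<open>U z\<close> and
  \<open>z\<close>.\<close>

lemma extension_deriv_inner_base:
  assumes x: "x \<noteq> 0"
  shows "A x w \<bullet> x = - (U x \<bullet> w)"
proof -
  have "((\<lambda>z. U z \<bullet> z) has_derivative (\<lambda>w. U x \<bullet> w + A x w \<bullet> x)) (at x)"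
    by (rule has_derivative_inner[OF has_derivative_extension[OF x] has_derivative_ident])
  moreover have "((\<lambda>z. U z \<bullet> z) has_derivative (\<lambda>w. 0)) (at x)"
    by (simp add: homogeneous_extension_orthogonal)
  ultimately have "(\<lambda>w. U x \<bullet> w + A x w \<bullet> x) = (\<lambda>w. 0)" by (rule has_derivative_unique)
  from fun_cong[OF this, of w] show ?thesis by simp
qed

text \<open>Derivative of the identity between the squared norms of \<open>U z\<close> and
  \<open>z\<close>.\<close>

lemma extension_deriv_inner_extension:
  assumes x: "x \<noteq> 0"
  shows "A x w \<bullet> U x = x \<bullet> w"
proof -
  have "((\<lambda>z. U z \<bullet> U z) has_derivative (\<lambda>w. U x \<bullet> A x w + A x w \<bullet> U x)) (at x)"
    by (rule has_derivative_inner[OF has_derivative_extension[OF x] has_derivative_extension[OF x]])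
  moreover have "(\<lambda>z. U z \<bullet> U z) = (\<lambda>z. z \<bullet> z)"
    by (simp add: dot_square_norm norm_homogeneous_extension)
  moreover have "((\<lambda>z. z \<bullet> z) has_derivative (\<lambda>w. x \<bullet> w + w \<bullet> x)) (at x)"
    by (rule has_derivative_inner[OF has_derivative_ident has_derivative_ident])
  ultimately have "(\<lambda>w. U x \<bullet> A x w + A x w \<bullet> U x) = (\<lambda>w. x \<bullet> w + w \<bullet> x)"
    by (metis has_derivative_unique)
  from fun_cong[OF this, of w] show ?thesis by (simp add: inner_commute)
qed

lemma homogeneous_extension_sphere: "y \<in> sphere 0 r \<Longrightarrow> U y = r *\<^sub>R v y"
  using r by (simp add: homogeneous_extension_def)

text \<open>The field \<open>U\<close> divided by \<open>r\<close> is an extension of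
  \<open>v\<close> off the sphere, so its derivative computes the differential of
  \<open>v\<close>.\<close>

lemma sphere_differential_eq_extension_deriv:
  assumes y: "y \<in> sphere 0 r" and X: "X \<in> sphere_tangent y"
  shows "sphere_differential v y X = (1 / r) *\<^sub>R A y X"
proof -
  have y0: "y \<noteq> 0" "norm y = r" using y r by auto
  have "((\<lambda>z. (1 / r) *\<^sub>R U z) has_derivative (\<lambda>w. (1 / r) *\<^sub>R A y w)) (at y)"
    by (rule has_derivative_scaleR_right[OF has_derivative_extension[OF y0(1)]])
  from sphere_differential_eq[OF y0(1) X this open_UNIV UNIV_I] show ?thesis
    using r y0 by (simp add: homogeneous_extension_sphere)
qed

lemma differentiable_within_sphere:
  assumes y: "y \<in> sphere 0 r"
  shows "v differentiable (at y within sphere 0 (norm y))"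
proof -
  have y0: "y \<noteq> 0" "norm y = r" using y r by auto
  have "((\<lambda>z. (1 / r) *\<^sub>R U z) has_derivative (\<lambda>w. (1 / r) *\<^sub>R A y w)) (at y within sphere 0 r)"
    by (rule has_derivative_at_withinI[OF has_derivative_scaleR_right[OF has_derivative_extension[OF y0(1)]]])
  then have "(v has_derivative (\<lambda>w. (1 / r) *\<^sub>R A y w)) (at y within sphere 0 r)"
    by (rule has_derivative_transform[OF y, rotated]) (use r in \<open>simp add: homogeneous_extension_sphere\<close>)
  then show ?thesis using y0(2) by (auto simp: differentiable_def)
qed

text \<open>On tangent vectors the covariant derivative is the tangential part of \<open>A y\<close>
  divided by \<open>r\<close>. The 2 that is subtracted consists of the squared length 1 of
  \<open>A y u\<close> and of the squared normal components of \<open>A y\<close> on tangent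
  vectors, which also sum to 1.\<close>

lemma nabla_norm_sq_bound:
  assumes y: "y \<in> sphere 0 r" and dim: "DIM('a) = 2 * n + 2" "n \<ge> 1"
  shows "nabla_norm_sq v y = (frobenius_sq (A y) - 2) / r\<^sup>2"
    and "minor_sum (A y) - 2 \<le> (2 * real n - 1) * (frobenius_sq (A y) - 2)"
proof -
  have y0: "y \<noteq> 0" "norm y = r" using y r by auto
  define u where "u = sgn y"
  have yu: "y = r *\<^sub>R u" using y0 r by (simp add: u_def sgn_div_norm)
  have u1: "norm u = 1" using y0 by (simp add: u_def norm_sgn)
  have uu: "u \<bullet> u = 1" using u1 by (simp add: dot_square_norm)
  have vy: "u \<bullet> v y = 0" "norm (v y) = 1" using v_props[OF y] r by (auto simp: yu)
  have T: "{x. u \<bullet> x = 0} = sphere_tangent y"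
    using r by (auto simp: sphere_tangent_def yu)
  have lin: "linear (A y)" by (rule linear_extension_deriv[OF y0(1)])
  have "(0::'a) \<in> sphere_tangent y" by (simp add: sphere_tangent_def)
  from sphere_differential_eq_extension_deriv[OF y this]
  have "sphere_differential v y 0 = 0" by (simp add: linear_0[OF lin])
  \<comment> \<open>Euler's relation: for the radial vector the tangential term vanishes.\<close>
  then have Au: "A y u = v y"
    using y0 uu r by (simp add: extension_deriv_def flip: u_def)
  have Lu: "A y w \<bullet> u = - (v y \<bullet> w)" for w
  proof -
    have "A y w \<bullet> y = - (r * (v y \<bullet> w))"
      using extension_deriv_inner_base[OF y0(1), of w]
      by (simp add: homogeneous_extension_sphere[OF y])
    also have "A y w \<bullet> y = r * (A y w \<bullet> u)" by (subst (2) yu) simp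
    finally have "r * (A y w \<bullet> u) = r * - (v y \<bullet> w)" by simp
    then show ?thesis using r by (simp only: mult_cancel_left) simp
  qed
  have Lv: "A y w \<bullet> v y = u \<bullet> w" for w
  proof -
    have "r * (A y w \<bullet> v y) = y \<bullet> w"
      using extension_deriv_inner_extension[OF y0(1), of w]
      by (simp add: homogeneous_extension_sphere[OF y])
    also have "y \<bullet> w = r * (u \<bullet> w)" by (subst yu) simp
    finally show ?thesis using r by simp
  qed
  obtain C where C: "orthonormal_basis_of {x. u \<bullet> x = 0} C"
    "(\<Sum>a\<in>C. \<Sum>b\<in>C. (A y b \<bullet> a)\<^sup>2) = frobenius_sq (A y) - 2"
    and "minor_sum (A y) - 2 \<le> (2 * real n - 1) * (frobenius_sq (A y) - 2)"
    by (rule minor_sum_le_frobenius_sq[OF lin u1 vy(2,1) Au Lu Lv dim])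
  show "minor_sum (A y) - 2 \<le> (2 * real n - 1) * (frobenius_sq (A y) - 2)" by fact
  have CT: "a \<in> sphere_tangent y" if "a \<in> C" for a
    using C(1) that span_base unfolding T orthonormal_basis_of_def by blast
  \<comment> \<open>The normal part removed by \<open>sphere_proj\<close> is orthogonal to the
    tangent vector \<open>a\<close>.\<close>
  have "sphere_connection v y b \<bullet> a = (A y b \<bullet> a) / r" if "a \<in> C" "b \<in> C" for a b
    using CT[OF that(1)] sphere_differential_eq_extension_deriv[OF y CT[OF that(2)]]
    by (simp add: sphere_connection_def sphere_proj_def sphere_tangent_def inner_diff_left)
  then have "nabla_norm_sq v y = (\<Sum>a\<in>C. \<Sum>b\<in>C. ((A y b \<bullet> a) / r)\<^sup>2)"
    using nabla_norm_sq_eq[OF differentiable_within_sphere[OF y] y0(1) C(1)[unfolded T]] by simp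
  then show "nabla_norm_sq v y = (frobenius_sq (A y) - 2) / r\<^sup>2"
    by (simp add: power_divide C(2) flip: sum_divide_distrib)
qed

lemmas continuous_extension_deriv = continuous_on_extension_deriv[OF smooth_v r]

lemma continuous_minor_sum_extension: "continuous_on (- {0}) (\<lambda>x. minor_sum (A x))"
  by (rule continuous_on_minor_sum[OF continuous_extension_deriv])

lemma continuous_frobenius_sq_extension: "continuous_on (- {0}) (\<lambda>x. frobenius_sq (A x))"
  unfolding frobenius_sq_def by (intro continuous_intros continuous_extension_deriv)

text \<open>For each basis vector the norm of the derivative is constant along rays, hence bounded;
  summing over the basis gives an operator bound uniform in the point.\<close>

lemma extension_deriv_bounded:
  obtains K where "\<And>x w. x \<noteq> 0 \<Longrightarrow> norm (A x w) \<le> K * norm w"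
proof -
  have "\<exists>K\<ge>0. \<forall>x. x \<noteq> 0 \<longrightarrow> norm (A x b) \<le> K" for b
  proof -
    have "\<exists>K\<ge>0. \<forall>x. x \<noteq> 0 \<longrightarrow> \<bar>norm (A x b)\<bar> \<le> K"
      by (rule radial_function_bounded[OF _ r])
        (simp_all add: continuous_extension_deriv continuous_on_norm extension_deriv_radial[OF r])
    then show ?thesis by simp
  qed
  then obtain K where K: "\<And>b. K b \<ge> 0" "\<And>b x. x \<noteq> 0 \<Longrightarrow> norm (A x b) \<le> K b" by metis
  have "norm (A x w) \<le> (\<Sum>b\<in>Basis. K b) * norm w" if x: "x \<noteq> 0" for x w
  proof -
    have lin: "linear (A x)" by (rule linear_extension_deriv[OF x])
    have "A x w = A x (\<Sum>b\<in>Basis. (w \<bullet> b) *\<^sub>R b)" by (simp only: euclidean_representation)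
    also have "\<dots> = (\<Sum>b\<in>Basis. (w \<bullet> b) *\<^sub>R A x b)"
      by (simp only: linear_sum[OF lin] linear_scale[OF lin])
    also have "norm \<dots> \<le> (\<Sum>b\<in>Basis. K b * norm w)"
      using K(2)[OF x] Basis_le_norm[of _ w]
      by (intro order_trans[OF norm_sum sum_mono]) (auto simp: mult.commute[of "K _"] intro!: mult_mono)
    finally show ?thesis by (simp add: sum_distrib_right)
  qed
  then show ?thesis by (rule that)
qed

end

section \<open>Integration of the pointwise bound and evaluation of the constants\<close>

theorem corollary1:
  fixes n :: nat and r :: real and \<epsilon> :: int
    and f v :: "real ^ 'd \<Rightarrow> real ^ ('d::finite)"
  assumes "n \<ge> 1" and "CARD('d) = 2 * n + 2" and "r > 0"
    and "\<epsilon> \<in> {1, -1}"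
    and "isometric_immersion r f"
    and "normal_degree r \<epsilon> f = 1"
    and "unit_vector_field r v"
  shows "energy r v \<ge>
    ((2 * real n + 1) / 2 * r ^ (2 * n + 1) + real n / (2 * real n - 1) * r ^ (2 * n - 1))
      * sphere_vol TYPE(real ^ 'd) 1"
proof -
  note n = assms(1) and r = assms(3) and v = assms(7)
  let ?A = "extension_deriv r v" and ?S = "ball (0 :: real ^ 'd) r - {0}"
  let ?p = "\<lambda>x :: real ^ 'd. (r / norm x) *\<^sub>R x" and ?R = "restrict_space lborel (ball (0 :: real ^ 'd) r - {0})"
  have dim: "DIM(real ^ 'd) = 2 * n + 2" using assms(2) by simp
  define V where "V = measure lborel (ball (0 :: real ^ 'd) r)"
  define \<omega> where "\<omega> = measure lborel (ball (0 :: real ^ 'd) 1)"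
  have V: "V = r ^ (2 * n + 2) * \<omega>"
    using r content_ball_conv_unit_ball[of r "0 :: real ^ 'd"] dim by (simp add: V_def \<omega>_def)
  obtain K where K: "\<And>x w. x \<noteq> 0 \<Longrightarrow> norm (?A x w) \<le> K * norm w"
    using extension_deriv_bounded[OF v r] by blast
  have minors: "2 * real (n + 1) * V \<le> (\<integral>x. minor_sum (?A x) \<partial>?R)"
    unfolding V_def
  proof (rule minor_sum_integral_bound[where U = "homogeneous_extension r v", OF _ r])
    show "CARD('d) = 2 * (n + 1)" using assms(2) by simp
  qed (fact continuous_homogeneous_extension[OF v r] norm_homogeneous_extension[OF v r]
      homogeneous_extension_orthogonal[OF v r] has_derivative_extension[OF v r]
      continuous_extension_deriv[OF v r] K)+
  have S: "?S \<in> sets borel" "bounded ?S" by auto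
  have int: "integrable ?R h"
    if h: "continuous_on (- {0}) h" and inv: "\<And>x. x \<noteq> 0 \<Longrightarrow> h (?p x) = h x" for h :: "real ^ 'd \<Rightarrow> real"
  proof -
    have "\<exists>M\<ge>0. \<forall>x. x \<noteq> 0 \<longrightarrow> \<bar>h x\<bar> \<le> M"
      by (rule radial_function_bounded[OF h r]) (rule inv)
    then obtain M where M: "\<forall>x. x \<noteq> 0 \<longrightarrow> \<bar>h x\<bar> \<le> M" by blast
    have "continuous_on ?S h" by (rule continuous_on_subset[OF h]) auto
    then show ?thesis
      by (rule integrable_continuous_bounded_lborel(1)[OF _ _ S, of h M]) (simp add: M)
  qed
  have int_m: "integrable ?R (\<lambda>x. minor_sum (?A x))"
    by (rule int[OF continuous_minor_sum_extension[OF v r]]) (simp add: extension_deriv_radial[OF r])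
  have int_f: "integrable ?R (\<lambda>x. frobenius_sq (?A x))"
    by (rule int[OF continuous_frobenius_sq_extension[OF v r]]) (simp add: extension_deriv_radial[OF r])
  have int_c: "integrable ?R (\<lambda>x. c)" for c :: real
    by (rule int) auto
  have c: "(\<integral>x. (2 :: real) \<partial>?R) = 2 * V"
  proof -
    have "measure ?R (space ?R) = V"
      by (simp add: space_restrict_space measure_restrict_space V_def) (subst measure_Diff_null_set, auto)
    then show ?thesis by simp
  qed
  note bound = nabla_norm_sq_bound[OF v r _ dim n]
  \<comment> \<open>The frame in \<open>nabla_norm_sq\<close> is chosen anew at each point;
    measurability follows from the frame-free, continuous expression on the sphere.\<close>
  have meas: "nabla_norm_sq v \<in> borel_measurable (restrict_space borel (sphere 0 r))"
  proof -
    have "continuous_on (sphere 0 r) (\<lambda>y. (frobenius_sq (?A y) - 2) / r\<^sup>2)"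
      using r by (intro continuous_intros continuous_on_subset[OF continuous_frobenius_sq_extension[OF v r]]) auto
    then have "continuous_on (sphere 0 r) (nabla_norm_sq v)"
      by (rule continuous_on_eq) (simp add: bound)
    then show ?thesis by (rule borel_measurable_continuous_on_restrict)
  qed
  have pn: "2 * real n - 1 > 0" using n by simp
  have rad: "nabla_norm_sq v (?p x) = (frobenius_sq (?A x) - 2) / r\<^sup>2"
    "minor_sum (?A x) - 2 \<le> (2 * real n - 1) * (frobenius_sq (?A x) - 2)" if "x \<noteq> 0" for x
    using bound[OF radial_projection_in_sphere[OF r that]] by (simp_all add: extension_deriv_radial[OF r that])
  \<comment> \<open>Half the ambient dimension is \<open>n + 1\<close>; subtracting the plane's
    contribution 2 from the integrand lowers the factor \<open>2 * (n + 1)\<close> to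
    \<open>2 * n\<close>.\<close>
  have "2 * real n * V \<le> (\<integral>x. minor_sum (?A x) - 2 \<partial>?R)"
    using minors c int_m int_c by (simp add: algebra_simps)
  also have "\<dots> \<le> (\<integral>x. (2 * real n - 1) * (frobenius_sq (?A x) - 2) \<partial>?R)"
    using int_m int_f int_c rad(2)
    by (intro integral_mono) (auto simp: space_restrict_space)
  also have "\<dots> = (2 * real n - 1) * (\<integral>x. frobenius_sq (?A x) - 2 \<partial>?R)"
    by simp
  also have "(\<integral>x. frobenius_sq (?A x) - 2 \<partial>?R) = (\<integral>x. r\<^sup>2 * nabla_norm_sq v (?p x) \<partial>?R)"
    using r by (intro Bochner_Integration.integral_cong) (auto simp: space_restrict_space rad(1))
  finally have "2 * real n * V \<le> (2 * real n - 1) * (r\<^sup>2 * (\<integral>x. nabla_norm_sq v (?p x) \<partial>?R))"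
    by simp
  then have "2 * real n * V / ((2 * real n - 1) * r\<^sup>2) \<le> (\<integral>x. nabla_norm_sq v (?p x) \<partial>?R)"
    using pn r by (simp add: field_simps)
  \<comment> \<open>Back from the ball to the sphere, with the normalising factor of the cone
    measure.\<close>
  then have "1 / 2 * (real DIM(real ^ 'd) / r * (2 * real n * V / ((2 * real n - 1) * r\<^sup>2)))
      \<le> 1 / 2 * (\<integral>x. nabla_norm_sq v x \<partial>sphere_measure r)"
    unfolding integral_sphere_measure[OF r meas] using r by (intro mult_left_mono) auto
  moreover have "1 / 2 * (real DIM(real ^ 'd) / r * (2 * real n * V / ((2 * real n - 1) * r\<^sup>2)))
      = real n / (2 * real n - 1) * r ^ (2 * n - 1) * sphere_vol TYPE(real ^ 'd) 1"
  proof -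
    \<comment> \<open>The volume \<open>V\<close> scales with \<open>r ^ (2 * n + 2)\<close>; three
      powers are cancelled by \<open>r\<^sup>2\<close> and the cone factor \<open>1 / r\<close>. As
      \<open>n\<close> is at least 1, the subtraction in the exponent is not truncated.\<close>
    have "r ^ (2 * n + 2) = r ^ (2 * n - 1) * r ^ 3"
      using n by (simp flip: power_add)
    then show ?thesis
      using r pn sphere_vol_eq[of 1, where 'a = "real ^ 'd"]
      by (simp add: V \<omega>_def[symmetric] power2_eq_square power3_eq_cube)
  qed
  moreover have "real (DIM(real ^ 'd) - 1) / 2 * sphere_vol TYPE(real ^ 'd) r
      = (2 * real n + 1) / 2 * r ^ (2 * n + 1) * sphere_vol TYPE(real ^ 'd) 1"
  proof -
    have "sphere_vol TYPE(real ^ 'd) r = r ^ (2 * n + 1) * sphere_vol TYPE(real ^ 'd) 1"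
      using sphere_vol_eq[OF r, where 'a = "real ^ 'd"] sphere_vol_eq[of 1, where 'a = "real ^ 'd"] dim
      by simp
    moreover have "real (DIM(real ^ 'd) - 1) = 2 * real n + 1" using dim by simp
    ultimately show ?thesis by simp
  qed
  ultimately show ?thesis unfolding energy_def distrib_right by linarith
qed

end
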